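(* Suppose $\sigma_k>\sigma_{k+1}$. For given $P_{XY}$, there exists a positive constant $\epsilon_0>0$ that depends only on $P_{XY}$, such that for all $\epsilon\in(0,\epsilon_0)$ and $\delta\in(0,1)$, $$\mathbb P_n\left\{\|\tilde{\mathbf B}\mathbf\Phi_k\|_{\mathrm F}^2-\|\tilde{\mathbf B}\hat{\mathbf\Phi}_k\|_{\mathrm F}^2>\epsilon\right\}<\delta$$ for all $n>N^{(4\alpha_k)}(\epsilon,\delta)$, where $$N^{(t)}(\epsilon,\delta)=\frac{t|\mathcal X||\mathcal Y|}{\epsilon}\log\frac{6t|\mathcal X||\mathcal Y|}{\epsilon}+\frac t\epsilon\log\frac1\delta .$$
   Context: Setting. Let $\mathcal X=\{1,\dots,|\mathcal X|\}$ and $\mathcal Y=\{1,\dots,|\mathcal Y|\}$ be finite alphabets and $P_{XY}$ a joint probability distribution on $\mathcal X\times\mathcal Y$ whose marginals satisfy $P_X(x)>0$, $P_Y(y)>0$ for all $x,y$. Let $d=|\mathcal X|$. The matrix $\tilde{\mathbf B}\in\mathbb R^{|\mathcal Y|\times|\mathcal X|}$ has entries $\tilde B(y,x)=\frac{P_{XY}(x,y)-P_X(x)P_Y(y)}{\sqrt{P_X(x)P_Y(y)}}$. Let $\sigma_1\ge\dots\ge\sigma_d\ge0$ be its singular values ($\sigma_i=0$ for $i>|\mathcal Y|$) and $\boldsymbol\phi_1,\dots,\boldsymbol\phi_d\in\mathbb R^d$ corresponding orthonormal right singular vectors (so $\tilde{\mathbf B}^{\mathrm T}\tilde{\mathbf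 B}\boldsymbol\phi_i=\sigma_i^2\boldsymbol\phi_i$). Fix $k\in\{1,\dots,d-1\}$ and let $\mathbf\Phi_k=[\boldsymbol\phi_1,\dots,\boldsymbol\phi_k]$. $\|\cdot\|_{\mathrm F}$ is the Frobenius norm; logarithms are natural. Estimation. Given $n$ i.i.d. samples $(x_i,y_i)$ from $P_{XY}$ (probability $\mathbb P_n$), let $\hat P_{XY}$ be their empirical joint distribution with marginals $\hat P_X,\hat P_Y$, let $\hat{\mathbf B}\in\mathbb R^{|\mathcal Y|\times|\mathcal X|}$ have entries $\hat B(y,x)=\frac{\hat P_{XY}(x,y)}{\sqrt{\hat P_X(x)\hat P_Y(y)}}-\sqrt{\hat P_X(x)\hat P_Y(y)}$, and let $\hat{\mathbf\Phi}_k\in\mathbb R^{d\times k}$ be the matrix whose orthonormal columns are right singular vectors of $\hat{\mathbf B}$ for its $k$ largest singular values. (An arbitrary fixed convention is used when a denominator vanishes or singular values tie.) Definition of $\alpha_k$. Let $\mathbf L$ be the $(|\mathcal X||\mathcal Y|)\times(|\mathcal X||\mathcal Y|)$ matrix whose entry in row $(x-1)|\mathcal Y|+y$ and column $(x'-1)|\mathcal Y|+y'$ is $$\sqrt{\frac{P_{XY}(x',y')}{P_X(x)P_Y(y)}}\left[\delta_{xx'}\delta_{yy'}-\frac12\left(\frac{\delta_{xx'}}{P_X(x)}+\frac{\delta_{yy'}}{P_Y(y)}\right)\left(P_{XY}(x,y)+P_X(x)P_Y(y)\right)\right].$$ Let $\boldsymbol\theta_{ij}=\boldsymbol\phi_j\otimes(\tilde{\mathbf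 B}\boldsymbol\phi_i)+\boldsymbol\phi_i\otimes(\tilde{\mathbf B}\boldsymbol\phi_j)$ (Kronecker products). Then $$\mathbf G_k=\mathbf L^{\mathrm T}\left(\sum_{i=1}^k\sum_{j=k+1}^d\frac{\boldsymbol\theta_{ij}\boldsymbol\theta_{ij}^{\mathrm T}}{\sigma_i^2-\sigma_j^2}\right)\mathbf L$$ and $\alpha_k$ is the spectral norm of $\mathbf G_k$. *)

theory Defs
  imports "HOL-Probability.Probability"
begin

text \<open>The alphabets are finite types \<open>'x\<close> and \<open>'y\<close>; matrices with rows indexed by \<open>'y\<close> and columns
  by \<open>'x\<close> have type \<open>real ^ 'x ^ 'y\<close>, and the row/column index \<open>(x - 1)|Y| + y\<close> becomes the pair
  \<open>(x, y)\<close>. Singular values, singular vectors and the columns of the \<open>d \<times> k\<close> matrices are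
  families indexed by the naturals starting at 1.\<close>

subsection \<open>Singular vectors and norms\<close>

text \<open>\<open>s 1 \<ge> \<dots> \<ge> s d \<ge> 0\<close> (\<open>d\<close> the number of columns of \<open>A\<close>) are the singular values of \<open>A\<close>,
  padded with zeros if there are fewer rows than columns, and \<open>v 1, \<dots>, v d\<close> are corresponding
  orthonormal right singular vectors. The padding is automatic, because
  \<open>transpose A ** A\<close> has rank at most the number of rows.\<close>

definition right_singular_system ::
  "real ^ 'm ^ 'n \<Rightarrow> (nat \<Rightarrow> real) \<Rightarrow> (nat \<Rightarrow> real ^ 'm) \<Rightarrow> bool" where
  "right_singular_system A s v \<longleftrightarrow>
     (\<forall>i \<in> {1..CARD('m)}. 0 \<le> s i) \<and>
     antimono_on {1..CARD('m)} s \<and>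
     (\<forall>i \<in> {1..CARD('m)}. \<forall>j \<in> {1..CARD('m)}. v i \<bullet> v j = of_bool (i = j)) \<and>
     (\<forall>i \<in> {1..CARD('m)}. (transpose A ** A) *v v i = (s i)\<^sup>2 *\<^sub>R v i)"

definition top_right_singular_vectors ::
  "nat \<Rightarrow> real ^ 'm ^ 'n \<Rightarrow> (nat \<Rightarrow> real ^ 'm) \<Rightarrow> bool" where
  "top_right_singular_vectors k A V \<longleftrightarrow>
     (\<exists>s v. right_singular_system A s v \<and> (\<forall>i \<in> {1..k}. V i = v i))"

text \<open>The Frobenius norm of the matrix with columns \<open>C 1, \<dots>, C k\<close>. The product of a matrix \<open>A\<close>
  with the matrix with columns \<open>V i\<close> has columns \<open>A *v V i\<close>.\<close>

definition frob_norm :: "nat \<Rightarrow> (nat \<Rightarrow> real ^ 'n) \<Rightarrow> real" where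
  "frob_norm k C = sqrt (\<Sum>i=1..k. \<Sum>r\<in>UNIV. (C i $ r)\<^sup>2)"

definition spectral_norm :: "real ^ 'm ^ 'n \<Rightarrow> real" where
  "spectral_norm A = onorm (\<lambda>v. A *v v)"

definition kron :: "real ^ 'a \<Rightarrow> real ^ 'b \<Rightarrow> real ^ ('a \<times> 'b)" where
  "kron u v = (\<chi> p. u $ fst p * v $ snd p)"

definition outer :: "real ^ 'a \<Rightarrow> real ^ 'b \<Rightarrow> real ^ 'b ^ 'a" where
  "outer u v = (\<chi> a b. u $ a * v $ b)"

subsection \<open>The population quantities\<close>

abbreviation PX :: "('x \<times> 'y) pmf \<Rightarrow> 'x \<Rightarrow> real" where
  "PX P x \<equiv> pmf (map_pmf fst P) x"

abbreviation PY :: "('x \<times> 'y) pmf \<Rightarrow> 'y \<Rightarrow> real" where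
  "PY P y \<equiv> pmf (map_pmf snd P) y"

definition B_tilde :: "('x::finite \<times> 'y::finite) pmf \<Rightarrow> real ^ 'x ^ 'y" where
  "B_tilde P = (\<chi> y x. (pmf P (x, y) - PX P x * PY P y) / sqrt (PX P x * PY P y))"

definition L_mat :: "('x::finite \<times> 'y::finite) pmf \<Rightarrow> real ^ ('x \<times> 'y) ^ ('x \<times> 'y)" where
  "L_mat P = (\<chi> r c. case (r, c) of ((x, y), (x', y')) \<Rightarrow>
     sqrt (pmf P (x', y') / (PX P x * PY P y)) *
       (of_bool (x = x') * of_bool (y = y') -
        1 / 2 * (of_bool (x = x') / PX P x + of_bool (y = y') / PY P y) *
          (pmf P (x, y) + PX P x * PY P y)))"

definition theta ::
  "('x::finite \<times> 'y::finite) pmf \<Rightarrow> (nat \<Rightarrow> real ^ 'x) \<Rightarrow> nat \<Rightarrow> nat \<Rightarrow> real ^ ('x \<times> 'y)" where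
  "theta P \<phi> i j = kron (\<phi> j) (B_tilde P *v \<phi> i) + kron (\<phi> i) (B_tilde P *v \<phi> j)"

definition G_mat ::
  "('x::finite \<times> 'y::finite) pmf \<Rightarrow> (nat \<Rightarrow> real) \<Rightarrow> (nat \<Rightarrow> real ^ 'x) \<Rightarrow> nat
     \<Rightarrow> real ^ ('x \<times> 'y) ^ ('x \<times> 'y)" where
  "G_mat P \<sigma> \<phi> k =
     transpose (L_mat P) **
     (\<Sum>i=1..k. \<Sum>j=k+1..CARD('x).
        (1 / ((\<sigma> i)\<^sup>2 - (\<sigma> j)\<^sup>2)) *\<^sub>R outer (theta P \<phi> i j) (theta P \<phi> i j)) **
     L_mat P"

definition alpha ::
  "('x::finite \<times> 'y::finite) pmf \<Rightarrow> (nat \<Rightarrow> real) \<Rightarrow> (nat \<Rightarrow> real ^ 'x) \<Rightarrow> nat \<Rightarrow> real" where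
  "alpha P \<sigma> \<phi> k = spectral_norm (G_mat P \<sigma> \<phi> k)"

subsection \<open>Sampling and estimation\<close>

definition iid_samples :: "nat \<Rightarrow> 'a pmf \<Rightarrow> (nat \<Rightarrow> 'a) pmf" where
  "iid_samples n P = Pi_pmf {..<n} undefined (\<lambda>_. P)"

text \<open>The empirical distribution of \<open>\<omega> 0, \<dots>, \<omega> (n - 1)\<close> is the law of \<open>\<omega> i\<close> at a uniformly random
  index \<open>i < n\<close>.\<close>

definition empirical :: "nat \<Rightarrow> (nat \<Rightarrow> 'a) \<Rightarrow> 'a pmf" where
  "empirical n \<omega> = map_pmf \<omega> (pmf_of_set {..<n})"

lemma pmf_empirical:
  assumes "n > 0"
  shows "pmf (empirical n \<omega>) a = card {i. i < n \<and> \<omega> i = a} / n"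
proof -
  have "{..<n} \<noteq> {}" using assms by auto
  moreover have "{..<n} \<inter> \<omega> -` {a} = {i. i < n \<and> \<omega> i = a}" by auto
  ultimately show ?thesis
    by (simp add: empirical_def pmf_map measure_pmf_of_set)
qed

text \<open>The matrix \<open>F\<close> supplies the entries with a vanishing denominator.\<close>

definition B_hat :: "real ^ 'x ^ 'y \<Rightarrow> ('x::finite \<times> 'y::finite) pmf \<Rightarrow> real ^ 'x ^ 'y" where
  "B_hat F Q = (\<chi> y x.
     if PX Q x * PY Q y = 0 then F $ y $ x
     else pmf Q (x, y) / sqrt (PX Q x * PY Q y) - sqrt (PX Q x * PY Q y))"

text \<open>\<open>m\<close> stands for \<open>|X||Y|\<close>.\<close>

definition N_bound :: "real \<Rightarrow> nat \<Rightarrow> real \<Rightarrow> real \<Rightarrow> real" where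
  "N_bound t m \<epsilon> \<delta> = t * m / \<epsilon> * ln (6 * t * m / \<epsilon>) + t / \<epsilon> * ln (1 / \<delta>)"

end

theory Submission
  imports Defs
begin

text \<open>Let \<open>M = B_tilde\<^sup>T B_tilde\<close>, let \<open>D\<close> be the difference of the empirical and the true
  top-\<open>k\<close> spectral projections and \<open>h\<close> the perturbation of \<open>M\<close>. Idempotence of the projections turns
  the loss \<open>- tr (M D)\<close> into the sum over \<open>i \<le> k < j\<close> of \<open>(\<sigma>\<^sub>i\<^sup>2 - \<sigma>\<^sub>j\<^sup>2) D\<^sub>i\<^sub>j\<^sup>2\<close> up to fourth order, and since the empirical
  projection commutes with the empirical matrix, \<open>(\<sigma>\<^sub>i\<^sup>2 - \<sigma>\<^sub>j\<^sup>2) D\<^sub>i\<^sub>j = h\<^sub>i\<^sub>j\<close> up to second order. The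
  first-order part of \<open>h\<^sub>i\<^sub>j\<close> is \<open>\<theta>\<^sub>i\<^sub>j \<bullet> L \<xi>\<close> with \<open>\<xi> = (Q - P) / sqrt P\<close>, so near \<open>P\<close> the loss is at most
  about \<open>\<alpha>\<^sub>k \<parallel>\<xi>\<parallel>\<^sup>2\<close>, that is about \<open>2 \<alpha>\<^sub>k\<close> times the relative entropy of \<open>Q\<close> and \<open>P\<close>. A loss above a
  small \<open>\<epsilon>\<close> therefore forces relative entropy at least \<open>(5/4) \<epsilon> / (4 \<alpha>\<^sub>k)\<close>, and the method of types
  bounds the probability of this event; the factor \<open>5/4\<close> absorbs the polynomial number of types.
  The argument divides by \<open>\<alpha>\<^sub>k\<close>, which is at least \<open>\<sigma>\<^sub>1\<^sup>2 / 4 > 0\<close>.\<close>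

section \<open>Second-order perturbation of a spectral projection\<close>

text \<open>The weight missing from the first \<open>k\<close> places reappears after them, and each
  unit moved loses at least the gap. This serves twice: with the gap for the unperturbed matrix, and
  as Ky Fan's maximum principle for the perturbed one.\<close>

lemma ky_fan_weights:
  fixes \<mu> w :: "nat \<Rightarrow> real"
  assumes k: "1 \<le> k" "k < d" and mono: "antimono_on {1..d} \<mu>"
    and w: "\<And>c. c \<in> {1..d} \<Longrightarrow> 0 \<le> w c \<and> w c \<le> 1" and sum_w: "(\<Sum>c=1..d. w c) = k"
  shows "(\<mu> k - \<mu> (k+1)) * (\<Sum>c=k+1..d. w c) \<le> (\<Sum>c=1..k. \<mu> c) - (\<Sum>c=1..d. \<mu> c * w c)"
proof -
  have split: "(\<Sum>c=1..d. f c) = (\<Sum>c=1..k. f c) + (\<Sum>c=k+1..d. f c)" for f :: "nat \<Rightarrow> real"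
    using sum.ub_add_nat[of 1 k f "d - k"] k by simp
  have "\<mu> k * (\<Sum>c=1..k. 1 - w c) \<le> (\<Sum>c=1..k. \<mu> c * (1 - w c))"
    unfolding sum_distrib_left using k w mono
    by (intro sum_mono mult_right_mono) (auto simp: monotone_on_def)
  moreover have "(\<Sum>c=k+1..d. \<mu> c * w c) \<le> \<mu> (k+1) * (\<Sum>c=k+1..d. w c)"
    unfolding sum_distrib_left using k w mono
    by (intro sum_mono mult_right_mono) (auto simp: monotone_on_def)
  moreover have "(\<Sum>c=1..k. 1 - w c) = (\<Sum>c=k+1..d. w c)"
    using split[of w] sum_w by (simp add: sum_subtractf)
  ultimately show ?thesis
    unfolding split[of "\<lambda>c. \<mu> c * w c"] by (simp add: algebra_simps sum_subtractf)
qed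

text \<open>Here \<open>u a c\<close> stands for the inner product of the \<open>a\<close>-th eigenvector of a matrix (eigenvalues
  \<open>\<nu>\<close>) with the \<open>c\<close>-th eigenvector of a perturbed matrix (eigenvalues \<open>\<mu>\<close>). In the unperturbed
  eigenbasis, \<open>W \<mu>\<close> is the perturbed matrix, \<open>W sel\<close> its top-\<open>k\<close> spectral projection, \<open>pert\<close> the
  perturbation, and \<open>dev\<close> the difference of the two projections.\<close>

locale eigenbasis_change =
  fixes d k :: nat and u :: "nat \<Rightarrow> nat \<Rightarrow> real" and \<nu> \<mu> :: "nat \<Rightarrow> real"
  assumes k: "1 \<le> k" "k < d"
    and rows: "\<And>a b. a \<in> {1..d} \<Longrightarrow> b \<in> {1..d} \<Longrightarrow> (\<Sum>c=1..d. u a c * u b c) = of_bool (a = b)"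
    and cols: "\<And>a b. a \<in> {1..d} \<Longrightarrow> b \<in> {1..d} \<Longrightarrow> (\<Sum>c=1..d. u c a * u c b) = of_bool (a = b)"
    and antimono_l: "antimono_on {1..d} \<nu>" and antimono_m: "antimono_on {1..d} \<mu>"
    and l_nonneg: "\<And>i. i \<in> {1..d} \<Longrightarrow> 0 \<le> \<nu> i"
begin

definition W :: "(nat \<Rightarrow> real) \<Rightarrow> nat \<Rightarrow> nat \<Rightarrow> real" where
  "W s a b = (\<Sum>e=1..d. s e * u a e * u b e)"

definition sel :: "nat \<Rightarrow> real" where
  "sel a = of_bool (a \<le> k)"

definition dev :: "nat \<Rightarrow> nat \<Rightarrow> real" where
  "dev a b = W sel a b - of_bool (a = b) * sel a"

definition pert :: "nat \<Rightarrow> nat \<Rightarrow> real" where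
  "pert a b = W \<mu> a b - of_bool (a = b) * \<nu> a"

text \<open>Trace of the unperturbed matrix against its own top projection minus its trace against
  the perturbed one.\<close>

definition loss :: real where
  "loss = (\<Sum>i=1..k. \<nu> i) - (\<Sum>a=1..d. \<nu> a * W sel a a)"

definition sqdev :: real where
  "sqdev = (\<Sum>a=1..d. \<Sum>b=1..d. (dev a b)\<^sup>2)"

lemma split_sum: "(\<Sum>c=1..d. f c) = (\<Sum>c=1..k. f c) + (\<Sum>c=k+1..d. f c)" for f :: "nat \<Rightarrow> real"
  using sum.ub_add_nat[of 1 k f "d - k"] k by simp

lemma sum_sel: "(\<Sum>c=1..d. sel c * f c) = (\<Sum>c=1..k. f c)"
proof -
  have "(\<Sum>c=k+1..d. sel c * f c) = 0" by (intro sum.neutral) (auto simp: sel_def)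
  moreover have "(\<Sum>c=1..k. sel c * f c) = (\<Sum>c=1..k. f c)" by (intro sum.cong) (auto simp: sel_def)
  ultimately show ?thesis by (simp add: split_sum del: One_nat_def)
qed

lemma W_sym: "W s a b = W s b a"
  by (simp add: W_def mult_ac)

lemma dev_sym: "dev a b = dev b a"
  by (auto simp: dev_def W_sym)

lemma delta_sum:
  assumes "b \<in> {1..d}"
  shows "(\<Sum>c=1..d. of_bool (c = b) * f c) = (f b :: real)"
    "(\<Sum>c=1..d. of_bool (b = c) * f c) = (f b :: real)"
  using assms by (simp_all add: of_bool_def if_distrib[of "\<lambda>x. x * _"] cong: if_cong)

text \<open>\<open>W s\<close> is \<open>U diag(s) U^T\<close> with \<open>U\<close> orthogonal, so
  \<open>cols\<close> collapses the inner product \<open>U^T U\<close> and the spectra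
  multiply.\<close>

lemma W_mult:
  assumes "a \<in> {1..d}" "b \<in> {1..d}"
  shows "(\<Sum>c=1..d. W s a c * W t c b) = W (\<lambda>e. s e * t e) a b"
proof -
  have "(\<Sum>c=1..d. W s a c * W t c b)
      = (\<Sum>c=1..d. \<Sum>e=1..d. \<Sum>f=1..d. (s e * u a e * u c e) * (t f * u c f * u b f))"
    by (simp add: W_def sum_product)
  also have "\<dots> = (\<Sum>e=1..d. \<Sum>f=1..d. \<Sum>c=1..d. (s e * u a e * u c e) * (t f * u c f * u b f))"
    by (subst sum.swap, rule sum.cong[OF refl], rule sum.swap)
  also have "\<dots> = (\<Sum>e=1..d. \<Sum>f=1..d. of_bool (e = f) * (s e * u a e * t f * u b f))"
  proof (intro sum.cong refl)
    fix e f assume "e \<in> {1..d}" "f \<in> {1..d}"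
    then have "of_bool (e = f) * (s e * u a e * t f * u b f)
      = (\<Sum>c=1..d. u c e * u c f) * (s e * u a e * t f * u b f)"
      using cols by simp
    also have "\<dots> = (\<Sum>c=1..d. (s e * u a e * u c e) * (t f * u c f * u b f))"
      unfolding sum_distrib_right by (intro sum.cong refl) (simp add: mult_ac)
    finally show "(\<Sum>c=1..d. (s e * u a e * u c e) * (t f * u c f * u b f))
      = of_bool (e = f) * (s e * u a e * t f * u b f)" by simp
  qed
  also have "\<dots> = W (\<lambda>e. s e * t e) a b"
    unfolding W_def by (intro sum.cong refl) (subst delta_sum, auto simp: mult_ac)
  finally show ?thesis .
qed

text \<open>Idempotence of both projections. In the block form given by \<open>k\<close>, the square
  of \<open>dev\<close> is \<open>- dev\<close> on the top block, \<open>dev\<close> on the bottom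
  block and zero on the mixed blocks. Hence the diagonal blocks of \<open>dev\<close> are of second
  order.\<close>

lemma dev_mult:
  assumes "a \<in> {1..d}" "b \<in> {1..d}"
  shows "(\<Sum>c=1..d. dev a c * dev c b) = (1 - sel a - sel b) * dev a b"
proof -
  have "(\<Sum>c=1..d. dev a c * dev c b)
     = (\<Sum>c=1..d. W sel a c * W sel c b) - (\<Sum>c=1..d. of_bool (a = c) * (sel a * W sel c b))
      - (\<Sum>c=1..d. of_bool (c = b) * (sel c * W sel a c)) + (\<Sum>c=1..d. of_bool (a = c) * (of_bool (c = b) * sel a * sel c))"
    unfolding sum_subtractf[symmetric] sum.distrib[symmetric]
    by (intro sum.cong refl) (simp add: dev_def algebra_simps)
  also have "\<dots> = W (\<lambda>e. sel e * sel e) a b - sel a * W sel a b - sel b * W sel a b + of_bool (a = b) * sel a * sel b"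
    using assms by (simp only: W_mult delta_sum, cases "a = b") auto
  also have "(\<lambda>e. sel e * sel e) = sel"
    by (auto simp: sel_def)
  also have "W sel a b - sel a * W sel a b - sel b * W sel a b + of_bool (a = b) * sel a * sel b = (1 - sel a - sel b) * dev a b"
    by (auto simp: dev_def algebra_simps sel_def)
  finally show ?thesis .
qed

lemma dev_row_sq:
  assumes "a \<in> {1..d}"
  shows "(\<Sum>b=1..d. (dev a b)\<^sup>2) = (1 - 2 * sel a) * dev a a"
  using dev_mult[OF assms assms] by (simp add: power2_eq_square dev_sym)

lemma W_sel_bounds:
  assumes "a \<in> {1..d}"
  shows "0 \<le> W sel a a \<and> W sel a a \<le> 1"
proof -
  have "W sel a a \<le> (\<Sum>c=1..d. u a c * u a c)"
    unfolding W_def by (intro sum_mono) (auto simp: sel_def)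
  then have "W sel a a \<le> 1" using rows[OF assms assms] by simp
  moreover have "0 \<le> W sel a a"
    unfolding W_def by (intro sum_nonneg) (auto simp: sel_def)
  ultimately show ?thesis by simp
qed

lemma sum_W_sel: "(\<Sum>a=1..d. W sel a a) = k"
proof -
  have "(\<Sum>a=1..d. W sel a a) = (\<Sum>e=1..d. sel e * (\<Sum>a=1..d. u a e * u a e))"
    unfolding W_def by (subst sum.swap) (simp add: sum_distrib_left mult_ac)
  also have "\<dots> = (\<Sum>e=1..d. sel e * 1)"
    by (intro sum.cong refl) (simp add: cols del: One_nat_def)
  also have "\<dots> = k"
    unfolding sum_sel by simp
  finally show ?thesis .
qed

text \<open>Both projections have trace \<open>k\<close>, so the diagonal mass lost in the top block
  equals the mass gained in the bottom block.\<close>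

lemma sqdev_eq: "sqdev = 2 * (\<Sum>a=k+1..d. W sel a a)"
proof -
  have "sqdev = (\<Sum>a=1..d. (1 - 2 * sel a) * dev a a)"
    by (simp add: sqdev_def dev_row_sq del: One_nat_def)
  also have "\<dots> = (\<Sum>a=1..k. 1 - W sel a a) + (\<Sum>a=k+1..d. W sel a a)"
    unfolding split_sum by (intro arg_cong2[of _ _ _ _ "(+)"] sum.cong refl) (auto simp: sel_def dev_def)
  also have "\<dots> = 2 * (\<Sum>a=k+1..d. W sel a a)"
    using sum_W_sel unfolding split_sum by (simp add: sum_subtractf)
  finally show ?thesis .
qed

lemma gap_sqdev_le_loss: "(\<nu> k - \<nu> (k+1)) * (sqdev / 2) \<le> loss"
  using ky_fan_weights[OF k antimono_l W_sel_bounds sum_W_sel] by (simp add: sqdev_eq loss_def)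

lemma loss_eq: "loss = - (\<Sum>a=1..d. \<nu> a * dev a a)"
proof -
  have "(\<Sum>a=1..d. \<nu> a * dev a a) = (\<Sum>a=1..d. \<nu> a * W sel a a) - (\<Sum>a=1..d. sel a * \<nu> a)"
    unfolding sum_subtractf[symmetric] by (intro sum.cong refl) (simp add: dev_def algebra_simps)
  then show ?thesis unfolding loss_def sum_sel by simp
qed

text \<open>The perturbed projection is optimal for the perturbed matrix, so the loss is at most the
  change of the two objective functions.\<close>

lemma loss_le_pert_dev: "loss \<le> (\<Sum>a=1..d. \<Sum>b=1..d. pert a b * dev a b)"
proof -
  \<comment> \<open>The diagonal of the unperturbed projection in the perturbed eigenbasis.\<close>
  define w where "w c = (\<Sum>i=1..k. u i c * u i c)" for c
  have "0 \<le> w c \<and> w c \<le> 1" if "c \<in> {1..d}" for c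
  proof -
    have "w c \<le> (\<Sum>i=1..d. u i c * u i c)"
      unfolding w_def split_sum using sum_nonneg[of "{k+1..d}" "\<lambda>i. u i c * u i c"] by simp
    then show ?thesis using cols[OF that that] by (auto simp: w_def intro: sum_nonneg)
  qed
  moreover have "(\<Sum>c=1..d. w c) = k"
  proof -
    have "(\<Sum>c=1..d. w c) = (\<Sum>i=1..k. \<Sum>c=1..d. u i c * u i c)"
      unfolding w_def by (rule sum.swap)
    also have "\<dots> = (\<Sum>i=1..k. 1)"
      using k by (intro sum.cong refl) (subst rows, auto)
    finally show ?thesis by simp
  qed
  ultimately have "(\<mu> k - \<mu> (k+1)) * (\<Sum>c=k+1..d. w c) \<le> (\<Sum>c=1..k. \<mu> c) - (\<Sum>c=1..d. \<mu> c * w c)"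
    by (rule ky_fan_weights[OF k antimono_m])
  moreover have "0 \<le> (\<mu> k - \<mu> (k+1)) * (\<Sum>c=k+1..d. w c)"
    using antimono_m k by (intro mult_nonneg_nonneg sum_nonneg) (auto simp: monotone_on_def w_def intro: sum_nonneg)
  ultimately have opt: "(\<Sum>c=1..d. \<mu> c * w c) \<le> (\<Sum>c=1..k. \<mu> c)" by simp
  \<comment> \<open>The trace of \<open>pert\<close> times \<open>dev\<close> is the perturbed
    objective at its own projection, minus the perturbed objective at the unperturbed projection,
    plus the loss. By \<open>opt\<close> the difference of the first two is nonnegative.\<close>
  have "(\<Sum>a=1..d. \<Sum>b=1..d. pert a b * dev a b)
      = (\<Sum>a=1..d. \<Sum>b=1..d. W \<mu> a b * W sel b a) - (\<Sum>a=1..d. \<Sum>b=1..d. of_bool (a = b) * (W \<mu> a b * sel a))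
        - (\<Sum>a=1..d. \<Sum>b=1..d. of_bool (a = b) * (\<nu> a * dev a b))"
    unfolding sum_subtractf[symmetric]
    by (intro sum.cong refl) (simp add: dev_def pert_def W_sym algebra_simps)
  also have "\<dots> = (\<Sum>a=1..d. W (\<lambda>e. \<mu> e * sel e) a a) - (\<Sum>a=1..d. sel a * W \<mu> a a) - (\<Sum>a=1..d. \<nu> a * dev a a)"
    by (simp only: W_mult delta_sum mult.commute[of _ "sel _"] cong: sum.cong)
  also have "(\<Sum>a=1..d. W (\<lambda>e. \<mu> e * sel e) a a) = (\<Sum>e=1..d. sel e * (\<mu> e * (\<Sum>a=1..d. u a e * u a e)))"
    unfolding W_def by (subst sum.swap) (simp add: sum_distrib_left mult_ac)
  also have "\<dots> = (\<Sum>e=1..d. sel e * \<mu> e)"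
    by (intro sum.cong refl) (simp add: cols del: One_nat_def)
  also have "\<dots> = (\<Sum>e=1..k. \<mu> e)" by (rule sum_sel)
  also have "(\<Sum>a=1..d. sel a * W \<mu> a a) = (\<Sum>c=1..d. \<mu> c * w c)"
    unfolding sum_sel unfolding w_def W_def sum_distrib_left by (subst sum.swap) (simp add: mult_ac)
  finally show ?thesis using opt by (simp add: loss_eq)
qed

lemma sqdev_nonneg: "0 \<le> sqdev"
  by (simp add: sqdev_def sum_nonneg)

lemma abs_dev_le:
  assumes "a \<in> {1..d}" "b \<in> {1..d}"
  shows "\<bar>dev a b\<bar> \<le> sqrt sqdev"
proof -
  have "(dev a b)\<^sup>2 \<le> (\<Sum>b=1..d. (dev a b)\<^sup>2)"
    using assms(2) by (intro member_le_sum) auto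
  also have "\<dots> \<le> sqdev"
    unfolding sqdev_def using assms(1)
    by (intro member_le_sum[of a _ "\<lambda>a. \<Sum>b=1..d. (dev a b)\<^sup>2"]) (auto intro: sum_nonneg)
  finally show ?thesis by (metis real_sqrt_abs real_sqrt_le_iff)
qed

text \<open>A Davis-Kahan type bound: the loss is at least the gap times \<open>sqdev / 2\<close>
  and at most a multiple of \<eta> times \<open>sqrt sqdev\<close>, so one root cancels.\<close>

lemma sqrt_sqdev_le:
  assumes g: "0 < g" "g \<le> \<nu> k - \<nu> (k+1)"
    and \<eta>: "\<And>a b. a \<in> {1..d} \<Longrightarrow> b \<in> {1..d} \<Longrightarrow> \<bar>pert a b\<bar> \<le> \<eta>"
  shows "sqrt sqdev \<le> 2 * (real d)\<^sup>2 * \<eta> / g"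
proof -
  have \<eta>0: "0 \<le> \<eta>" using \<eta>[of 1 1] k by simp
  have "g * (sqdev / 2) \<le> loss"
    using g sqdev_nonneg gap_sqdev_le_loss mult_right_mono[of g "\<nu> k - \<nu> (k+1)" "sqdev / 2"] by linarith
  also have "\<dots> \<le> (\<Sum>a=1..d. \<Sum>b=1..d. pert a b * dev a b)" by (rule loss_le_pert_dev)
  also have "\<dots> \<le> (\<Sum>a=1..d. \<Sum>b=1..d. \<eta> * sqrt sqdev)"
  proof (intro sum_mono)
    fix a b assume "a \<in> {1..d}" "b \<in> {1..d}"
    then have "\<bar>pert a b\<bar> * \<bar>dev a b\<bar> \<le> \<eta> * sqrt sqdev"
      by (intro mult_mono \<eta> abs_dev_le \<eta>0) auto
    then show "pert a b * dev a b \<le> \<eta> * sqrt sqdev"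
      by (metis abs_ge_self abs_mult order_trans)
  qed
  also have "\<dots> = (real d)\<^sup>2 * \<eta> * sqrt sqdev" by (simp add: power2_eq_square)
  finally have "g * (sqrt sqdev * sqrt sqdev / 2) \<le> (real d)\<^sup>2 * \<eta> * sqrt sqdev"
    using sqdev_nonneg by simp
  then have "(g * sqrt sqdev) * sqrt sqdev \<le> (2 * (real d)\<^sup>2 * \<eta>) * sqrt sqdev" by (simp add: algebra_simps)
  then have "g * sqrt sqdev \<le> 2 * (real d)\<^sup>2 * \<eta> \<or> sqrt sqdev = 0"
    using sqdev_nonneg by (cases "sqdev = 0") (auto simp: mult_le_cancel_right)
  then show ?thesis
    using g \<eta>0 by (auto simp: field_simps)
qed

text \<open>An entry of the commutator of \<open>dev\<close> and \<open>pert\<close>: a product of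
  two small quantities, hence a second-order remainder.\<close>

definition comm :: "nat \<Rightarrow> nat \<Rightarrow> real" where
  "comm i j = (\<Sum>c=1..d. dev i c * pert c j - pert i c * dev c j)"

text \<open>The perturbed projection commutes with the perturbed matrix, both being of the form
  \<open>W\<close>. Expanding the two products in \<open>dev\<close> and \<open>pert\<close> leaves
  this exact equation.\<close>

lemma dev_off_diagonal:
  assumes "i \<in> {1..k}" "j \<in> {k+1..d}"
  shows "(\<nu> i - \<nu> j) * dev i j = pert i j + comm i j"
proof -
  have ij: "i \<in> {1..d}" "j \<in> {1..d}" "sel i = 1" "sel j = 0" "i \<noteq> j"
    using assms k by (auto simp: sel_def)
  have "(\<Sum>c=1..d. W sel i c * W \<mu> c j) = (\<Sum>c=1..d. W \<mu> i c * W sel c j)"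
    using ij unfolding W_mult[OF ij(1,2)] by (simp add: mult.commute)
  moreover have "(\<Sum>c=1..d. W sel i c * W \<mu> c j) = (\<Sum>c=1..d. dev i c * pert c j)
     + (\<Sum>c=1..d. of_bool (i = c) * (sel i * pert c j)) + (\<Sum>c=1..d. of_bool (c = j) * (dev i c * \<nu> c))
     + (\<Sum>c=1..d. of_bool (i = c) * (sel i * of_bool (c = j) * \<nu> c))"
    unfolding sum.distrib[symmetric]
    by (intro sum.cong refl) (simp add: dev_def pert_def algebra_simps)
  moreover have "(\<Sum>c=1..d. W \<mu> i c * W sel c j) = (\<Sum>c=1..d. pert i c * dev c j)
     + (\<Sum>c=1..d. of_bool (i = c) * (\<nu> i * dev c j)) + (\<Sum>c=1..d. of_bool (c = j) * (pert i c * sel c))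
     + (\<Sum>c=1..d. of_bool (i = c) * (\<nu> i * of_bool (c = j) * sel c))"
    unfolding sum.distrib[symmetric]
    by (intro sum.cong refl) (simp add: dev_def pert_def algebra_simps)
  ultimately show ?thesis
    using ij by (simp only: comm_def sum_subtractf delta_sum) (simp add: algebra_simps)
qed

lemma abs_comm_le:
  assumes \<eta>: "\<And>a b. a \<in> {1..d} \<Longrightarrow> b \<in> {1..d} \<Longrightarrow> \<bar>pert a b\<bar> \<le> \<eta>"
    and ij: "i \<in> {1..d}" "j \<in> {1..d}"
  shows "\<bar>comm i j\<bar> \<le> 2 * real d * \<eta> * sqrt sqdev"
proof -
  have \<eta>0: "0 \<le> \<eta>" using \<eta>[of 1 1] k by simp
  have "\<bar>comm i j\<bar> \<le> (\<Sum>c=1..d. \<bar>dev i c * pert c j - pert i c * dev c j\<bar>)"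
    unfolding comm_def by (rule sum_abs)
  also have "\<dots> \<le> (\<Sum>c=1..d. 2 * \<eta> * sqrt sqdev)"
  proof (rule sum_mono)
    fix c assume c: "c \<in> {1..d}"
    have "\<bar>dev i c * pert c j - pert i c * dev c j\<bar> \<le> \<bar>dev i c\<bar> * \<bar>pert c j\<bar> + \<bar>pert i c\<bar> * \<bar>dev c j\<bar>"
      by (metis abs_mult abs_triangle_ineq4)
    also have "\<dots> \<le> sqrt sqdev * \<eta> + \<eta> * sqrt sqdev"
      using ij c by (intro add_mono mult_mono \<eta> abs_dev_le \<eta>0) (auto simp: sqdev_nonneg)
    finally show "\<bar>dev i c * pert c j - pert i c * dev c j\<bar> \<le> 2 * \<eta> * sqrt sqdev" by simp
  qed
  finally show ?thesis by simp
qed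

text \<open>\<open>dev_row_sq\<close> makes the loss quadratic in \<open>dev\<close>. The mixed
  blocks combine to eigenvalue differences, the bottom block enters with a negative sign and is
  dropped, and the top block is of fourth order because \<open>dev\<close> is there minus the
  corresponding entry of its square.\<close>

lemma loss_le_off_diagonal:
  "loss \<le> (\<Sum>i=1..k. \<Sum>j=k+1..d. (\<nu> i - \<nu> j) * (dev i j)\<^sup>2) + (real d)\<^sup>2 * \<nu> 1 * (real d * sqdev)\<^sup>2"
proof -
  have "loss = (\<Sum>a=1..d. \<nu> a * (2 * sel a - 1) * (\<Sum>b=1..d. (dev a b)\<^sup>2))"
    unfolding loss_eq sum_negf[symmetric]
    by (intro sum.cong refl) (subst dev_row_sq, auto simp: sel_def)
  also have "\<dots> = (\<Sum>i=1..k. \<nu> i * (\<Sum>b=1..d. (dev i b)\<^sup>2)) - (\<Sum>j=k+1..d. \<nu> j * (\<Sum>b=1..d. (dev j b)\<^sup>2))"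
    unfolding split_sum[of "\<lambda>a. \<nu> a * (2 * sel a - 1) * _ a"] by (simp add: sel_def sum_negf)
  also have "\<dots> = (\<Sum>i=1..k. \<Sum>j=k+1..d. \<nu> i * (dev i j)\<^sup>2) + (\<Sum>i=1..k. \<Sum>j=1..k. \<nu> i * (dev i j)\<^sup>2)
      - (\<Sum>j=k+1..d. \<Sum>i=1..k. \<nu> j * (dev j i)\<^sup>2) - (\<Sum>j=k+1..d. \<Sum>i=k+1..d. \<nu> j * (dev j i)\<^sup>2)"
    unfolding split_sum[of "\<lambda>b. (dev _ b)\<^sup>2"]
    by (simp add: sum_distrib_left sum.distrib distrib_left del: One_nat_def)
  also have "(\<Sum>j=k+1..d. \<Sum>i=1..k. \<nu> j * (dev j i)\<^sup>2) = (\<Sum>i=1..k. \<Sum>j=k+1..d. \<nu> j * (dev i j)\<^sup>2)"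
    by (subst sum.swap) (simp add: dev_sym)
  finally have "loss \<le> (\<Sum>i=1..k. \<Sum>j=k+1..d. (\<nu> i - \<nu> j) * (dev i j)\<^sup>2) + (\<Sum>i=1..k. \<Sum>j=1..k. \<nu> i * (dev i j)\<^sup>2)"
    using sum_nonneg[of "{k+1..d}" "\<lambda>j. \<Sum>i=k+1..d. \<nu> j * (dev j i)\<^sup>2"] l_nonneg
    by (auto simp: algebra_simps sum_subtractf sum_nonneg)
  also have "(\<Sum>i=1..k. \<Sum>j=1..k. \<nu> i * (dev i j)\<^sup>2) \<le> (\<Sum>i=1..k. \<Sum>j=1..k. \<nu> 1 * (real d * sqdev)\<^sup>2)"
  proof (intro sum_mono mult_mono)
    fix i j assume ij: "i \<in> {1..k}" "j \<in> {1..k}"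
    then have mem: "i \<in> {1..d}" "j \<in> {1..d}" "sel i = 1" "sel j = 1" using k by (auto simp: sel_def)
    then have "\<bar>dev i j\<bar> = \<bar>\<Sum>c=1..d. dev i c * dev c j\<bar>"
      unfolding dev_mult[OF mem(1,2)] by simp
    also have "\<dots> \<le> (\<Sum>c=1..d. \<bar>dev i c * dev c j\<bar>)"
      by (rule sum_abs)
    also have "\<dots> \<le> (\<Sum>c=1..d. sqrt sqdev * sqrt sqdev)"
      unfolding abs_mult using mem by (intro sum_mono mult_mono abs_dev_le) (auto simp: sqdev_nonneg)
    finally have "\<bar>dev i j\<bar> \<le> \<bar>d * sqdev\<bar>" using sqdev_nonneg by simp
    then show "(dev i j)\<^sup>2 \<le> (real d * sqdev)\<^sup>2" by (simp only: abs_le_square_iff)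
    show "\<nu> i \<le> \<nu> 1" using antimono_l ij k by (auto simp: monotone_on_def)
    show "0 \<le> \<nu> 1" using l_nonneg k by auto
  qed simp
  also have "\<dots> = (real k)\<^sup>2 * (\<nu> 1 * (real d * sqdev)\<^sup>2)" by (simp add: power2_eq_square)
  also have "\<dots> \<le> (real d)\<^sup>2 * (\<nu> 1 * (real d * sqdev)\<^sup>2)"
    using k l_nonneg[of 1] by (intro mult_right_mono power_mono mult_nonneg_nonneg) auto
  finally show ?thesis by (simp add: mult.assoc)
qed

text \<open>Here \<delta> is a first-order approximation of \<open>pert\<close>, \<eta> bounds the
  perturbation and \<rho> the error of the approximation. \<open>dev_off_diagonal\<close> replaces
  \<open>dev\<close> by \<delta> up to an error, and the factor \<open>5/4\<close> pays for the
  cross terms.\<close>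

lemma loss_le_quadratic:
  assumes g: "0 < g" "g \<le> \<nu> k - \<nu> (k+1)"
    and \<eta>: "\<And>a b. a \<in> {1..d} \<Longrightarrow> b \<in> {1..d} \<Longrightarrow> \<bar>pert a b\<bar> \<le> \<eta>"
    and \<rho>: "\<And>a b. a \<in> {1..d} \<Longrightarrow> b \<in> {1..d} \<Longrightarrow> \<bar>pert a b - \<delta> a b\<bar> \<le> \<rho>"
  shows "loss \<le> 5/4 * (\<Sum>i=1..k. \<Sum>j=k+1..d. (\<delta> i j)\<^sup>2 / (\<nu> i - \<nu> j))
    + 5 * (real d)\<^sup>2 / g * (\<rho> + 4 * real d^3 / g * \<eta>\<^sup>2)\<^sup>2 + (real d)\<^sup>2 * \<nu> 1 * (4 * real d^5 / g\<^sup>2 * \<eta>\<^sup>2)\<^sup>2"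
proof -
  have \<eta>0: "0 \<le> \<eta>" using \<eta>[of 1 1] k by simp
  have \<rho>0: "0 \<le> \<rho>" using \<rho>[of 1 1] k by simp
  have S: "sqrt sqdev \<le> 2 * (real d)\<^sup>2 * \<eta> / g" by (rule sqrt_sqdev_le[OF g \<eta>])
  have S2: "sqdev \<le> 4 * real d^4 * \<eta>\<^sup>2 / g\<^sup>2"
  proof -
    have "sqdev = (sqrt sqdev)\<^sup>2" using sqdev_nonneg by simp
    also have "\<dots> \<le> (2 * (real d)\<^sup>2 * \<eta> / g)\<^sup>2" using S by (intro power_mono) (auto simp: sqdev_nonneg)
    finally show ?thesis by (simp add: power_mult_distrib power_divide)
  qed
  have T: "(real d * sqdev)\<^sup>2 \<le> (4 * real d^5 / g\<^sup>2 * \<eta>\<^sup>2)\<^sup>2"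
  proof (rule power_mono)
    have "real d * sqdev \<le> d * (4 * real d^4 * \<eta>\<^sup>2 / g\<^sup>2)" using S2 by (intro mult_left_mono) auto
    also have "\<dots> = 4 * real d^5 / g\<^sup>2 * \<eta>\<^sup>2" by (simp add: eval_nat_numeral)
    finally show "real d * sqdev \<le> 4 * real d^5 / g\<^sup>2 * \<eta>\<^sup>2" .
  qed (simp add: sqdev_nonneg)
  have "(\<Sum>i=1..k. \<Sum>j=k+1..d. (\<nu> i - \<nu> j) * (dev i j)\<^sup>2)
     \<le> (\<Sum>i=1..k. \<Sum>j=k+1..d. 5/4 * ((\<delta> i j)\<^sup>2 / (\<nu> i - \<nu> j)) + 5 / g * (\<rho> + 4 * real d^3 / g * \<eta>\<^sup>2)\<^sup>2)"
  proof (intro sum_mono)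
    fix i j assume ij: "i \<in> {1..k}" "j \<in> {k+1..d}"
    then have mem: "i \<in> {1..d}" "j \<in> {1..d}" using k by auto
    have gij: "g \<le> \<nu> i - \<nu> j"
    proof -
      have "\<nu> k \<le> \<nu> i" "\<nu> j \<le> \<nu> (k+1)" using antimono_l ij k by (auto simp: monotone_on_def)
      then show ?thesis using g by simp
    qed
    define e where "e = pert i j - \<delta> i j + comm i j"
    have "\<bar>comm i j\<bar> \<le> 2 * real d * \<eta> * sqrt sqdev" by (rule abs_comm_le[OF \<eta> mem])
    also have "\<dots> \<le> 2 * real d * \<eta> * (2 * (real d)\<^sup>2 * \<eta> / g)" using S \<eta>0 by (intro mult_left_mono) auto
    also have "\<dots> = 4 * real d^3 / g * \<eta>\<^sup>2" by (simp add: eval_nat_numeral)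
    finally have "\<bar>e\<bar> \<le> \<rho> + 4 * real d^3 / g * \<eta>\<^sup>2"
      unfolding e_def using \<rho>[OF mem] by linarith
    then have e2: "e\<^sup>2 \<le> (\<rho> + 4 * real d^3 / g * \<eta>\<^sup>2)\<^sup>2"
      by (metis abs_ge_zero power2_abs power_mono)
    have "(\<nu> i - \<nu> j) * (dev i j)\<^sup>2 = ((\<nu> i - \<nu> j) * dev i j)\<^sup>2 / (\<nu> i - \<nu> j)"
      using gij g by (simp add: power2_eq_square)
    also have "(\<nu> i - \<nu> j) * dev i j = \<delta> i j + e"
      by (simp add: dev_off_diagonal[OF ij] e_def)
    also have "(\<delta> i j + e)\<^sup>2 / (\<nu> i - \<nu> j) \<le> (5/4 * (\<delta> i j)\<^sup>2 + 5 * e\<^sup>2) / (\<nu> i - \<nu> j)"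
    proof (rule divide_right_mono)
      \<comment> \<open>With \<open>x = \<delta> i j\<close>, this bounds the cross term
        \<open>2 * x * e\<close> by \<open>x^2 / 4 + 4 * e^2\<close>.\<close>
      have "0 \<le> (\<delta> i j / 2 - 2 * e)\<^sup>2" by simp
      then show "(\<delta> i j + e)\<^sup>2 \<le> 5/4 * (\<delta> i j)\<^sup>2 + 5 * e\<^sup>2" by (simp add: power2_eq_square algebra_simps)
    qed (use gij g in simp)
    also have "\<dots> = 5/4 * ((\<delta> i j)\<^sup>2 / (\<nu> i - \<nu> j)) + 5 * (e\<^sup>2 / (\<nu> i - \<nu> j))" by (simp add: add_divide_distrib)
    also have "e\<^sup>2 / (\<nu> i - \<nu> j) \<le> (\<rho> + 4 * real d^3 / g * \<eta>\<^sup>2)\<^sup>2 / g"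
      using gij g e2 by (intro frac_le) auto
    finally show "(\<nu> i - \<nu> j) * (dev i j)\<^sup>2 \<le> 5/4 * ((\<delta> i j)\<^sup>2 / (\<nu> i - \<nu> j)) + 5 / g * (\<rho> + 4 * real d^3 / g * \<eta>\<^sup>2)\<^sup>2"
      by simp
  qed
  also have "\<dots> = 5/4 * (\<Sum>i=1..k. \<Sum>j=k+1..d. (\<delta> i j)\<^sup>2 / (\<nu> i - \<nu> j))
     + (real k * real (d - k)) * (5 / g * (\<rho> + 4 * real d^3 / g * \<eta>\<^sup>2)\<^sup>2)"
    using k by (simp add: sum.distrib sum_distrib_left)
  also have "(real k * real (d - k)) * (5 / g * (\<rho> + 4 * real d^3 / g * \<eta>\<^sup>2)\<^sup>2) \<le> (real d)\<^sup>2 * (5 / g * (\<rho> + 4 * real d^3 / g * \<eta>\<^sup>2)\<^sup>2)"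
    unfolding power2_eq_square[of "real d"] using k g by (intro mult_right_mono mult_mono) auto
  finally have "(\<Sum>i=1..k. \<Sum>j=k+1..d. (\<nu> i - \<nu> j) * (dev i j)\<^sup>2)
    \<le> 5/4 * (\<Sum>i=1..k. \<Sum>j=k+1..d. (\<delta> i j)\<^sup>2 / (\<nu> i - \<nu> j)) + (real d)\<^sup>2 * (5 / g * (\<rho> + 4 * real d^3 / g * \<eta>\<^sup>2)\<^sup>2)" by simp
  moreover have "(real d)\<^sup>2 * \<nu> 1 * (real d * sqdev)\<^sup>2 \<le> (real d)\<^sup>2 * \<nu> 1 * (4 * real d^5 / g\<^sup>2 * \<eta>\<^sup>2)\<^sup>2"
    using T l_nonneg[of 1] k by (intro mult_left_mono) auto
  ultimately show ?thesis using loss_le_off_diagonal by simp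
qed

end

section \<open>Relative entropy and the method of types\<close>

text \<open>The difference of the two sides vanishes at 0 and has derivative
  \<open>s^2 / ((1 + s) * (2 + s)^2)\<close>.\<close>

lemma ln_one_plus_ge_two_mult_div:
  fixes t :: real
  assumes "0 \<le> t"
  shows "2 * t / (2 + t) \<le> ln (1 + t)"
proof -
  define f where "f s = ln (1 + s) - 2 * s / (2 + s)" for s :: real
  have "f 0 \<le> f t"
  proof (rule DERIV_nonneg_imp_nondecreasing[OF assms])
    fix s :: real assume s: "0 \<le> s" "s \<le> t"
    have "(f has_real_derivative (1 / (1 + s) - (2 * (2 + s) - 2 * s) / (2 + s)\<^sup>2)) (at s)"
      unfolding f_def using s by (auto intro!: derivative_eq_intros simp: power2_eq_square)
    moreover have "1 / (1 + s) - (2 * (2 + s) - 2 * s) / (2 + s)\<^sup>2 = s\<^sup>2 / ((1 + s) * (2 + s)\<^sup>2)"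
      using s by (simp add: divide_simps) (simp add: power2_eq_square algebra_simps)
    ultimately show "\<exists>y. (f has_real_derivative y) (at s) \<and> 0 \<le> y" using s by auto
  qed
  then show ?thesis by (simp add: f_def)
qed

text \<open>From 1 upwards the preceding logarithm bound gives exactly the left-hand side; below 1 a
  stronger bound with denominator 2 holds. Near \<open>u = 1\<close> the denominator tends to 2, the
  sharp value.\<close>

lemma entropy_summand_ge:
  fixes u :: real
  assumes "0 \<le> u"
  shows "(u - 1)\<^sup>2 / (2 + \<bar>u - 1\<bar>) \<le> u * ln u - u + 1"
proof (cases "1 \<le> u")
  case True
  have "u * (2 * (u - 1) / (2 + (u - 1))) \<le> u * ln (1 + (u - 1))"
    using True by (intro mult_left_mono ln_one_plus_ge_two_mult_div) auto
  moreover have "u * (2 * (u - 1) / (2 + (u - 1))) - u + 1 = (u - 1)\<^sup>2 / (2 + \<bar>u - 1\<bar>)"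
    using True by (simp add: divide_simps) (simp add: power2_eq_square algebra_simps)
  ultimately show ?thesis by simp
next
  case False
  have "(u - 1)\<^sup>2 / 2 \<le> u * ln u - u + 1"
  \<comment> \<open>At 0 the product \<open>0 * ln 0\<close> is 0, and only
    \<open>1/2 \<le> 1\<close> remains.\<close>
  proof (cases "u = 0")
    case False
    define f where "f s = s * ln s - s + 1 - (s - 1)\<^sup>2 / 2" for s :: real
    have "u \<le> 1" using \<open>\<not> 1 \<le> u\<close> by simp
    then have "f 1 \<le> f u"
    proof (rule DERIV_nonpos_imp_nonincreasing)
      fix s assume s: "u \<le> s" "s \<le> 1"
      have "(f has_real_derivative ln s - (s - 1)) (at s)"
        unfolding f_def using s assms False by (auto intro!: derivative_eq_intros simp: field_simps)
      moreover have "ln s - (s - 1) \<le> 0" using ln_le_minus_one[of s] s assms False by simp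
      ultimately show "\<exists>y. (f has_real_derivative y) (at s) \<and> y \<le> 0" by blast
    qed
    then show ?thesis by (simp add: f_def)
  qed simp
  moreover have "(u - 1)\<^sup>2 / (2 + \<bar>u - 1\<bar>) \<le> (u - 1)\<^sup>2 / 2" by (intro divide_left_mono) (auto intro!: mult_pos_pos add_pos_nonneg)
  ultimately show ?thesis by linarith
qed

text \<open>For \<open>Q\<close> supported in the support of \<open>P\<close> this is the relative
  entropy; symbols that \<open>Q\<close> misses contribute 0.\<close>

definition kl :: "'a pmf \<Rightarrow> 'a pmf \<Rightarrow> real" where
  "kl Q P = (\<Sum>a\<in>set_pmf P. pmf Q a * ln (pmf Q a / pmf P a))"

definition chi2 :: "'a pmf \<Rightarrow> 'a pmf \<Rightarrow> real" where
  "chi2 Q P = (\<Sum>a\<in>set_pmf P. (pmf Q a - pmf P a)\<^sup>2 / pmf P a)"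

text \<open>Sum \<open>entropy_summand_ge\<close> at the ratio of \<open>Q\<close> to
  \<open>P\<close>, weighted by \<open>P\<close>. The linear terms cancel because both distributions
  have mass one on the support of \<open>P\<close>.\<close>

lemma chi2_le_kl:
  fixes P Q :: "'a::finite pmf"
  assumes ac: "set_pmf Q \<subseteq> set_pmf P"
    and \<tau>: "\<And>a. a \<in> set_pmf P \<Longrightarrow> \<bar>pmf Q a - pmf P a\<bar> \<le> \<tau> * pmf P a"
  shows "chi2 Q P \<le> (2 + \<tau>) * kl Q P"
proof -
  have sums: "(\<Sum>a\<in>set_pmf P. pmf Q a) = 1" "(\<Sum>a\<in>set_pmf P. pmf P a) = 1"
    using ac by (auto intro!: sum_pmf_eq_1)
  have \<tau>0: "0 \<le> \<tau>"
  proof -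
    obtain a where a: "a \<in> set_pmf P" using set_pmf_not_empty[of P] by blast
    then have "0 \<le> \<tau> * pmf P a" using \<tau>[OF a] by linarith
    then show ?thesis using pmf_pos[of P a] a by (simp add: zero_le_mult_iff set_pmf_iff)
  qed
  have "chi2 Q P / (2 + \<tau>) \<le> (\<Sum>a\<in>set_pmf P. pmf Q a * ln (pmf Q a / pmf P a) - pmf Q a + pmf P a)"
    unfolding chi2_def sum_divide_distrib
  proof (rule sum_mono)
    fix a assume a: "a \<in> set_pmf P"
    define p where "p = pmf P a"
    define u where "u = pmf Q a / p"
    have p: "0 < p" using a pmf_nonneg[of P a] by (simp add: p_def set_pmf_iff less_le)
    have q: "pmf Q a = p * u" using p by (simp add: u_def)
    have "p * \<bar>u - 1\<bar> = \<bar>pmf Q a - p\<bar>" using p by (simp add: q abs_mult_pos' algebra_simps)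
    also have "\<dots> \<le> p * \<tau>" using \<tau>[OF a] by (simp add: p_def mult.commute)
    finally have u\<tau>: "\<bar>u - 1\<bar> \<le> \<tau>" using p by simp
    have "(pmf Q a - p)\<^sup>2 / p / (2 + \<tau>) = p * ((u - 1)\<^sup>2 / (2 + \<tau>))"
    proof -
      have "(pmf Q a - p)\<^sup>2 / p = p * (u - 1)\<^sup>2"
        using p by (simp add: q power2_eq_square divide_simps) (simp add: algebra_simps)
      then show ?thesis by simp
    qed
    also have "\<dots> \<le> p * ((u - 1)\<^sup>2 / (2 + \<bar>u - 1\<bar>))"
      using p u\<tau> by (intro mult_left_mono divide_left_mono) (auto intro!: mult_pos_pos)
    also have "\<dots> \<le> p * (u * ln u - u + 1)"
      using p by (intro mult_left_mono entropy_summand_ge) (auto simp: u_def)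
    also have "\<dots> = pmf Q a * ln (pmf Q a / p) - pmf Q a + p"
      using p by (simp add: q algebra_simps)
    finally show "(pmf Q a - pmf P a)\<^sup>2 / pmf P a / (2 + \<tau>) \<le> pmf Q a * ln (pmf Q a / pmf P a) - pmf Q a + pmf P a"
      by (simp add: p_def)
  qed
  also have "\<dots> = kl Q P" by (simp add: kl_def sum.distrib sum_subtractf sums)
  finally show ?thesis using \<tau>0 by (simp add: field_simps)
qed

section \<open>The method of types: samples grouped by their empirical distribution\<close>

lemma pmf_iid_samples:
  "pmf (iid_samples n P) \<omega> = (if \<forall>i. n \<le> i \<longrightarrow> \<omega> i = undefined then \<Prod>i<n. pmf P (\<omega> i) else 0)"
  unfolding iid_samples_def by (subst pmf_Pi) (auto simp: not_less)

lemma prod_eq_prod_counts: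
  fixes f :: "'a::finite \<Rightarrow> real" and n :: nat
  shows "(\<Prod>i<n. f (\<omega> i)) = (\<Prod>a\<in>UNIV. f a ^ card {i. i < n \<and> \<omega> i = a})"
proof -
  have "(\<Prod>i<n. f (\<omega> i)) = (\<Prod>a\<in>UNIV. \<Prod>i\<in>{i \<in> {..<n}. \<omega> i = a}. f (\<omega> i))"
    by (rule prod.group[symmetric]) auto
  then show ?thesis by simp
qed

lemma set_empirical_subset:
  assumes "n > 0" "\<omega> \<in> set_pmf (iid_samples n P)"
  shows "set_pmf (empirical n \<omega>) \<subseteq> set_pmf P"
proof
  fix a assume "a \<in> set_pmf (empirical n \<omega>)"
  then obtain i where i: "i < n" "a = \<omega> i"
    using assms(1) finite_lessThan[of n] by (auto simp: empirical_def lessThan_empty_iff)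
  have "pmf (iid_samples n P) \<omega> \<noteq> 0" using assms(2) by (simp add: set_pmf_iff)
  then have "(\<Prod>i<n. pmf P (\<omega> i)) \<noteq> 0" by (auto simp: pmf_iid_samples split: if_splits)
  then show "a \<in> set_pmf P" using i by (auto simp: set_pmf_iff)
qed

text \<open>The probability of a sample depends only on its symbol counts. Passing from its
  empirical distribution to \<open>P\<close> multiplies by one likelihood ratio per symbol, raised
  to its count, and these collect to the exponential.\<close>

lemma pmf_iid_samples_change:
  fixes P :: "'a::finite pmf"
  assumes n: "n > 0" and \<omega>: "\<omega> \<in> set_pmf (iid_samples n P)"
  shows "pmf (iid_samples n P) \<omega>
    = exp (- real n * kl (empirical n \<omega>) P) * pmf (iid_samples n (empirical n \<omega>)) \<omega>"
proof -
  define Q where "Q = empirical n \<omega>"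
  define N where "N a = card {i. i < n \<and> \<omega> i = a}" for a
  have Q: "pmf Q a = N a / n" for a using n by (simp add: Q_def N_def pmf_empirical)
  have und: "\<forall>i. n \<le> i \<longrightarrow> \<omega> i = undefined"
    using \<omega> by (auto simp: set_pmf_iff pmf_iid_samples split: if_splits)
  have ac: "set_pmf Q \<subseteq> set_pmf P" unfolding Q_def by (rule set_empirical_subset[OF n \<omega>])
  have "real n * kl Q P = (\<Sum>a\<in>set_pmf P. N a * ln (pmf Q a / pmf P a))"
    unfolding kl_def sum_distrib_left using n by (intro sum.cong) (auto simp: Q)
  also have "\<dots> = (\<Sum>a\<in>UNIV. N a * ln (pmf Q a / pmf P a))"
    using ac n by (intro sum.mono_neutral_left) (auto simp: set_pmf_iff Q)
  finally have "exp (- real n * kl Q P) * (\<Prod>a\<in>UNIV. pmf Q a ^ N a)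
      = (\<Prod>a\<in>UNIV. exp (- (N a * ln (pmf Q a / pmf P a))) * pmf Q a ^ N a)"
    by (simp add: exp_sum prod.distrib sum_negf[symmetric])
  also have "\<dots> = (\<Prod>a\<in>UNIV. pmf P a ^ N a)"
  proof (rule prod.cong[OF refl])
    fix a
    show "exp (- (N a * ln (pmf Q a / pmf P a))) * pmf Q a ^ N a = pmf P a ^ N a"
    proof (cases "N a = 0")
      case False
      then have q: "pmf Q a > 0" using n by (simp add: Q)
      then have p: "pmf P a > 0" using ac by (metis less_irrefl pmf_pos set_pmf_iff subset_iff)
      have "exp (- (N a * ln (pmf Q a / pmf P a))) = exp (N a * ln (pmf P a / pmf Q a))"
        using p q by (simp add: ln_div algebra_simps)
      also have "\<dots> = (pmf P a / pmf Q a) ^ N a"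
        using p q by (simp add: exp_of_nat_mult)
      finally show ?thesis using q by (simp add: power_divide)
    qed simp
  qed
  finally show ?thesis
    using und by (simp add: pmf_iid_samples prod_eq_prod_counts Q_def[symmetric] N_def)
qed

lemma finite_set_iid_samples: "finite (set_pmf (iid_samples n (P :: 'a::finite pmf)))"
proof (rule finite_subset)
  show "finite (PiE_dflt {..<n} undefined (\<lambda>_. UNIV :: 'a set))"
    by (rule finite_PiE_dflt) simp_all
  show "set_pmf (iid_samples n P) \<subseteq> PiE_dflt {..<n} undefined (\<lambda>_. UNIV)"
    by (auto simp: PiE_dflt_def set_pmf_iff pmf_iid_samples split: if_splits)
qed

text \<open>Sanov's bound. Each type class has probability at most one under its own type, so the
  change of measure leaves \<open>exp (- n * \<kappa>)\<close> per type, and the number of types is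
  polynomial in \<open>n\<close>.\<close>

lemma prob_kl_ge:
  fixes P :: "'a::finite pmf"
  assumes n: "n > 0"
    and A: "\<And>\<omega>. \<omega> \<in> A \<Longrightarrow> \<omega> \<in> set_pmf (iid_samples n P) \<Longrightarrow> \<kappa> \<le> kl (empirical n \<omega>) P"
  shows "measure_pmf.prob (iid_samples n P) A \<le> (real n + 1) ^ CARD('a) * exp (- real n * \<kappa>)"
proof -
  define S where "S = A \<inter> set_pmf (iid_samples n P)"
  define types where "types = (empirical n ` S)"
  have finS: "finite S" unfolding S_def using finite_set_iid_samples by blast
  define cnt where "cnt \<omega> = (\<lambda>a. card {i. i < n \<and> \<omega> i = a})" for \<omega> :: "nat \<Rightarrow> 'a"
  have "measure_pmf.prob (iid_samples n P) A = (\<Sum>\<omega>\<in>S. pmf (iid_samples n P) \<omega>)"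
    using finS by (simp add: S_def measure_Int_set_pmf measure_measure_pmf_finite[symmetric])
  also have "\<dots> \<le> (\<Sum>\<omega>\<in>S. exp (- real n * \<kappa>) * pmf (iid_samples n (empirical n \<omega>)) \<omega>)"
  proof (rule sum_mono)
    fix \<omega> assume "\<omega> \<in> S"
    then show "pmf (iid_samples n P) \<omega> \<le> exp (- real n * \<kappa>) * pmf (iid_samples n (empirical n \<omega>)) \<omega>"
      using A[of \<omega>] n by (subst pmf_iid_samples_change[OF n]) (auto simp: S_def intro!: mult_right_mono)
  qed
  also have "\<dots> = exp (- real n * \<kappa>) * (\<Sum>Q\<in>types. \<Sum>\<omega>\<in>{\<omega>\<in>S. empirical n \<omega> = Q}. pmf (iid_samples n (empirical n \<omega>)) \<omega>)"
    unfolding sum_distrib_left[symmetric] types_def using finS by (subst sum.group) auto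
  also have "\<dots> \<le> exp (- real n * \<kappa>) * (\<Sum>Q\<in>types. 1)"
  proof (intro mult_left_mono sum_mono)
    fix Q
    have "(\<Sum>\<omega>\<in>{\<omega>\<in>S. empirical n \<omega> = Q}. pmf (iid_samples n (empirical n \<omega>)) \<omega>)
      = measure_pmf.prob (iid_samples n Q) {\<omega>\<in>S. empirical n \<omega> = Q}"
      using finS by (subst measure_measure_pmf_finite) auto
    then show "(\<Sum>\<omega>\<in>{\<omega>\<in>S. empirical n \<omega> = Q}. pmf (iid_samples n (empirical n \<omega>)) \<omega>) \<le> 1"
      by (simp add: measure_pmf.prob_le_1)
  qed simp
  also have "(\<Sum>Q\<in>types. 1) = real (card types)" by simp
  also have "card types \<le> (n + 1) ^ CARD('a)"
  proof -
    \<comment> \<open>A type is recovered from its count vector, whose entries lie between 0 and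
      \<open>n\<close>; counting the vectors bounds the number of types.\<close>
    have "types \<subseteq> (\<lambda>c. SOME Q. \<forall>a. pmf Q a = real (c a) / n) ` (PiE UNIV (\<lambda>_. {0..n}))"
    proof
      fix Q assume "Q \<in> types"
      then obtain \<omega> where Q: "Q = empirical n \<omega>" by (auto simp: types_def)
      have "(SOME Q. \<forall>a. pmf Q a = real (cnt \<omega> a) / n) = Q"
      proof (rule some_equality)
        show "\<forall>a. pmf Q a = real (cnt \<omega> a) / n" using n by (simp add: Q pmf_empirical cnt_def)
        then show "Q' = Q" if "\<forall>a. pmf Q' a = real (cnt \<omega> a) / n" for Q' using that by (intro pmf_eqI) simp
      qed
      moreover have "cnt \<omega> a \<le> n" for a
        using card_mono[of "{..<n}" "{i. i < n \<and> \<omega> i = a}"] by (auto simp: cnt_def)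
      ultimately show "Q \<in> (\<lambda>c. SOME Q. \<forall>a. pmf Q a = real (c a) / n) ` (PiE UNIV (\<lambda>_. {0..n}))"
        by (auto intro!: image_eqI[of _ _ "cnt \<omega>"])
    qed
    then have "card types \<le> card (PiE (UNIV::'a set) (\<lambda>_. {0..n}))"
      by (meson card_image_le card_mono finite_PiE finite_imageI finite finite_atLeastAtMost le_trans)
    then show ?thesis by (simp add: card_PiE)
  qed
  finally show ?thesis
    by (simp add: mult.commute add.commute mult_left_mono)
qed

section \<open>The loss in terms of the Gram matrices\<close>

text \<open>Orthonormal vectors are independent, and \<open>CARD('n)\<close> independent vectors
  span the space.\<close>

lemma orthonormal_family_expansion:
  fixes v :: "nat \<Rightarrow> real ^ 'n" and w :: "real ^ 'n"
  assumes v: "\<And>i j. i \<in> {1..CARD('n)} \<Longrightarrow> j \<in> {1..CARD('n)} \<Longrightarrow> v i \<bullet> v j = of_bool (i = j)"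
  shows "(\<Sum>i=1..CARD('n). (w \<bullet> v i) *\<^sub>R v i) = w"
proof -
  define S where "S = v ` {1..CARD('n)}"
  \<comment> \<open>The basis expansion used below is about a set, so returning to the indexed
    family requires injectivity.\<close>
  have inj: "inj_on v {1..CARD('n)}"
  proof (rule inj_onI)
    fix i j assume ij: "i \<in> {1..CARD('n)}" "j \<in> {1..CARD('n)}" "v i = v j"
    then have "v i \<bullet> v j = 1" using v[of j j] by simp
    then show "i = j" using v[of i j] ij by (auto split: if_splits)
  qed
  have card: "card S = CARD('n)" unfolding S_def card_image[OF inj] by simp
  have orth: "pairwise orthogonal S"
    unfolding pairwise_def S_def orthogonal_def using v by auto
  have norm1: "norm x = 1" if "x \<in> S" for x
    using that v by (auto simp: S_def norm_eq_1)
  have "independent S"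
    using norm1 by (intro pairwise_orthogonal_independent[OF orth]) force
  then have "span S = UNIV"
    using card_ge_dim_independent[of S UNIV] card by (auto simp: S_def)
  then have "(\<Sum>b\<in>S. (w \<bullet> b) *\<^sub>R b) = w"
    using orthonormal_basis_expand[OF orth norm1, of w] by (simp add: S_def)
  then show ?thesis
    unfolding S_def by (simp add: sum.reindex[OF inj] del: One_nat_def)
qed

lemma orthonormal_family_parseval:
  fixes v :: "nat \<Rightarrow> real ^ 'n" and w z :: "real ^ 'n"
  assumes v: "\<And>i j. i \<in> {1..CARD('n)} \<Longrightarrow> j \<in> {1..CARD('n)} \<Longrightarrow> v i \<bullet> v j = of_bool (i = j)"
  shows "(\<Sum>i=1..CARD('n). (w \<bullet> v i) * (z \<bullet> v i)) = w \<bullet> z"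
proof -
  have "w \<bullet> z = (\<Sum>i=1..CARD('n). (w \<bullet> v i) *\<^sub>R v i) \<bullet> z"
    by (subst orthonormal_family_expansion[OF v]) auto
  also have "\<dots> = (\<Sum>i=1..CARD('n). (w \<bullet> v i) * (z \<bullet> v i))"
    by (simp add: inner_sum_left inner_commute[of "v _" z])
  finally show ?thesis by simp
qed

text \<open>The norm of a matrix, taken as a vector of vectors, is its Frobenius norm, so
  Cauchy-Schwarz row by row suffices.\<close>

lemma norm_matrix_vector_mult_le: "norm (A *v x) \<le> norm A * norm x" for A :: "real ^ 'm ^ 'n"
proof -
  have "(norm (A *v x))\<^sup>2 = (\<Sum>i\<in>UNIV. (A $ i \<bullet> x)\<^sup>2)"
    unfolding power2_norm_eq_inner inner_vec_def[of "A *v x"]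
    by (simp add: power2_eq_square matrix_vector_mul_component)
  also have "\<dots> \<le> (\<Sum>i\<in>UNIV. (norm (A $ i))\<^sup>2 * (norm x)\<^sup>2)"
    by (intro sum_mono) (metis Cauchy_Schwarz_ineq2 abs_ge_zero power2_abs power_mono power_mult_distrib)
  also have "\<dots> = (norm A * norm x)\<^sup>2"
    unfolding power_mult_distrib sum_distrib_right[symmetric] power2_norm_eq_inner inner_vec_def[of A] ..
  finally show ?thesis by (rule power2_le_imp_le) simp
qed

lemma abs_inner_matrix_le:
  fixes H :: "real ^ 'm ^ 'n"
  assumes "norm x = 1" "norm y = 1"
  shows "\<bar>y \<bullet> (H *v x)\<bar> \<le> norm H"
  using Cauchy_Schwarz_ineq2[of y "H *v x"] norm_matrix_vector_mult_le[of H x] assms by simp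

lemma inner_gram: "x \<bullet> ((transpose A ** B) *v y) = (A *v x) \<bullet> (B *v y)"
  for A B :: "real ^ 'm ^ 'n"
proof -
  have "x \<bullet> ((transpose A ** B) *v y) = ((B *v y) v* A) \<bullet> x"
    by (simp add: matrix_vector_mul_assoc[symmetric] inner_commute)
  then show ?thesis by (simp only: dot_lmul_matrix inner_commute[of "B *v y"])
qed

lemma frob_norm_sq: "(frob_norm k C)\<^sup>2 = (\<Sum>i=1..k. C i \<bullet> C i)"
  unfolding frob_norm_def by (subst real_sqrt_pow2)
    (auto intro!: sum_nonneg simp: inner_vec_def power2_eq_square)

lemma right_singular_systemD:
  fixes A :: "real ^ 'm ^ 'n"
  assumes "right_singular_system A s v"
  shows "\<And>i. i \<in> {1..CARD('m)} \<Longrightarrow> 0 \<le> s i"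
    and "\<And>i j. i \<in> {1..CARD('m)} \<Longrightarrow> j \<in> {1..CARD('m)} \<Longrightarrow> i \<le> j \<Longrightarrow> s j \<le> s i"
    and "\<And>i j. i \<in> {1..CARD('m)} \<Longrightarrow> j \<in> {1..CARD('m)} \<Longrightarrow> v i \<bullet> v j = of_bool (i = j)"
    and "\<And>i. i \<in> {1..CARD('m)} \<Longrightarrow> (transpose A ** A) *v v i = (s i)\<^sup>2 *\<^sub>R v i"
  using assms unfolding right_singular_system_def monotone_on_def by auto

lemma gram_spectral:
  fixes A :: "real ^ 'm ^ 'n"
  assumes sys: "right_singular_system A s v"
  shows "x \<bullet> ((transpose A ** A) *v y) = (\<Sum>c=1..CARD('m). (s c)\<^sup>2 * (x \<bullet> v c) * (y \<bullet> v c))"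
proof -
  note D = right_singular_systemD[OF sys]
  have "x \<bullet> ((transpose A ** A) *v y) = x \<bullet> ((transpose A ** A) *v (\<Sum>c=1..CARD('m). (y \<bullet> v c) *\<^sub>R v c))"
    by (subst orthonormal_family_expansion[OF D(3)]) auto
  also have "\<dots> = (\<Sum>c=1..CARD('m). (y \<bullet> v c) * (x \<bullet> ((transpose A ** A) *v v c)))"
    by (simp add: linear_sum[OF matrix_vector_mul_linear] inner_sum_right matrix_vector_mult_scaleR)
  also have "\<dots> = (\<Sum>c=1..CARD('m). (s c)\<^sup>2 * (x \<bullet> v c) * (y \<bullet> v c))"
    by (intro sum.cong refl) (subst D(4), auto)
  finally show ?thesis .
qed

text \<open>Applies \<open>eigenbasis_change\<close> to the overlaps of the two singular systems. In
  the basis \<phi> the difference of the Gram matrices has the entries \<open>pert\<close>, and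
  \<open>loss\<close> becomes the drop in squared Frobenius norm.\<close>

lemma frob_loss_le:
  fixes A A' :: "real ^ 'm ^ 'n"
  assumes sys: "right_singular_system A \<sigma> \<phi>" and sys': "right_singular_system A' s v"
    and k: "1 \<le> k" "k < CARD('m)"
    and g: "0 < g" "g \<le> (\<sigma> k)\<^sup>2 - (\<sigma> (k+1))\<^sup>2"
    and \<eta>: "norm (transpose A' ** A' - transpose A ** A) \<le> \<eta>"
    and \<rho>: "norm (transpose A' ** A' - transpose A ** A - \<Delta>) \<le> \<rho>"
  defines "d \<equiv> real CARD('m)"
  shows "(frob_norm k (\<lambda>i. A *v \<phi> i))\<^sup>2 - (frob_norm k (\<lambda>i. A *v v i))\<^sup>2
    \<le> 5/4 * (\<Sum>i=1..k. \<Sum>j=k+1..CARD('m). (\<phi> i \<bullet> (\<Delta> *v \<phi> j))\<^sup>2 / ((\<sigma> i)\<^sup>2 - (\<sigma> j)\<^sup>2))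
     + 5 * d\<^sup>2 / g * (\<rho> + 4 * d^3 / g * \<eta>\<^sup>2)\<^sup>2 + d\<^sup>2 * (\<sigma> 1)\<^sup>2 * (4 * d^5 / g\<^sup>2 * \<eta>\<^sup>2)\<^sup>2"
proof -
  note D = right_singular_systemD[OF sys] and D' = right_singular_systemD[OF sys']
  interpret E: eigenbasis_change "CARD('m)" k "\<lambda>a c. \<phi> a \<bullet> v c" "\<lambda>i. (\<sigma> i)\<^sup>2" "\<lambda>i. (s i)\<^sup>2"
  proof
    fix a b assume ab: "a \<in> {1..CARD('m)}" "b \<in> {1..CARD('m)}"
    show "(\<Sum>c=1..CARD('m). (\<phi> a \<bullet> v c) * (\<phi> b \<bullet> v c)) = of_bool (a = b)"
      using orthonormal_family_parseval[OF D'(3)] D(3) ab by simp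
    show "(\<Sum>c=1..CARD('m). (\<phi> c \<bullet> v a) * (\<phi> c \<bullet> v b)) = of_bool (a = b)"
      using orthonormal_family_parseval[OF D(3), of "v a" "v b"] D'(3) ab by (simp add: inner_commute)
  qed (use k D D' in \<open>auto simp: monotone_on_def power_mono\<close>)
  have pert: "E.pert a b = \<phi> a \<bullet> ((transpose A' ** A' - transpose A ** A) *v \<phi> b)"
    if "a \<in> {1..CARD('m)}" "b \<in> {1..CARD('m)}" for a b
    using that D(3) D(4)[OF that(2)]
    by (simp add: E.pert_def E.W_def gram_spectral[OF sys'] matrix_vector_mult_diff_rdistrib inner_diff_right)
  have "E.loss = (\<Sum>i=1..k. (\<sigma> i)\<^sup>2) - (\<Sum>a=1..CARD('m). (\<sigma> a)\<^sup>2 * (\<Sum>c=1..k. (\<phi> a \<bullet> v c) * (\<phi> a \<bullet> v c)))"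
    unfolding E.loss_def E.W_def mult.assoc E.sum_sel ..
  also have "(\<Sum>a=1..CARD('m). (\<sigma> a)\<^sup>2 * (\<Sum>c=1..k. (\<phi> a \<bullet> v c) * (\<phi> a \<bullet> v c)))
      = (\<Sum>c=1..k. (A *v v c) \<bullet> (A *v v c))"
    unfolding sum_distrib_left inner_gram[symmetric] gram_spectral[OF sys]
    by (subst sum.swap) (simp add: inner_commute mult_ac)
  also have "(\<Sum>i=1..k. (\<sigma> i)\<^sup>2) = (\<Sum>i=1..k. (A *v \<phi> i) \<bullet> (A *v \<phi> i))"
    unfolding inner_gram[symmetric] using k by (intro sum.cong refl) (subst D(4), auto simp: D(3))
  finally have loss: "E.loss = (frob_norm k (\<lambda>i. A *v \<phi> i))\<^sup>2 - (frob_norm k (\<lambda>i. A *v v i))\<^sup>2"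
    by (simp add: frob_norm_sq)
  have norm1: "norm (\<phi> a) = 1" if "a \<in> {1..CARD('m)}" for a
    using D(3)[OF that that] by (simp add: norm_eq_1)
  show ?thesis
    unfolding loss[symmetric] d_def
  proof (rule E.loss_le_quadratic[OF g])
    fix a b assume ab: "a \<in> {1..CARD('m)}" "b \<in> {1..CARD('m)}"
    show "\<bar>E.pert a b\<bar> \<le> \<eta>"
      unfolding pert[OF ab] by (rule order_trans[OF abs_inner_matrix_le[OF norm1[OF ab(2)] norm1[OF ab(1)]] \<eta>])
    have "E.pert a b - \<phi> a \<bullet> (\<Delta> *v \<phi> b) = \<phi> a \<bullet> ((transpose A' ** A' - transpose A ** A - \<Delta>) *v \<phi> b)"
      unfolding pert[OF ab] by (simp add: matrix_vector_mult_diff_rdistrib inner_diff_right)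
    then show "\<bar>E.pert a b - \<phi> a \<bullet> (\<Delta> *v \<phi> b)\<bar> \<le> \<rho>"
      using order_trans[OF abs_inner_matrix_le[OF norm1[OF ab(2)] norm1[OF ab(1)]] \<rho>] by simp
  qed
qed

section \<open>Marginals, vectorisation and the quadratic form of \<open>G_mat\<close>\<close>

lemma sum_prod_UNIV: "(\<Sum>a\<in>(UNIV :: ('x::finite \<times> 'y::finite) set). f a) = (\<Sum>x\<in>UNIV. \<Sum>y\<in>UNIV. f (x, y))"
  by (simp add: sum.cartesian_product)

lemma PX_eq_sum: "PX P x = (\<Sum>y\<in>UNIV. pmf P (x, y))" for P :: "('x::finite \<times> 'y::finite) pmf"
proof -
  have "fst -` {x} = (\<lambda>y. (x, y)) ` (UNIV :: 'y set)" by auto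
  then show ?thesis
    by (simp add: pmf_map measure_measure_pmf_finite sum.reindex inj_on_def)
qed

lemma PY_eq_sum: "PY P y = (\<Sum>x\<in>UNIV. pmf P (x, y))" for P :: "('x::finite \<times> 'y::finite) pmf"
proof -
  have "snd -` {y} = (\<lambda>x. (x, y)) ` (UNIV :: 'x set)" by auto
  then show ?thesis
    by (simp add: pmf_map measure_measure_pmf_finite sum.reindex inj_on_def)
qed

text \<open>Inverse of vectorisation: it sends \<open>kron a b\<close> to the rank-one matrix with
  column factor \<open>b\<close> and row factor \<open>a\<close>.\<close>

definition mat_of :: "real ^ ('x \<times> 'y) \<Rightarrow> real ^ 'x ^ 'y" where
  "mat_of w = (\<chi> y x. w $ (x, y))"

lemma kron_inner: "kron a b \<bullet> w = b \<bullet> (mat_of w *v a)"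
  for a :: "real ^ 'x::finite" and b :: "real ^ 'y::finite"
proof -
  have "kron a b \<bullet> w = (\<Sum>y\<in>UNIV. \<Sum>x\<in>UNIV. a $ x * b $ y * w $ (x, y))"
    unfolding inner_vec_def sum_prod_UNIV by (subst sum.swap) (simp add: kron_def)
  then show ?thesis
    by (simp add: inner_vec_def matrix_vector_mult_def mat_of_def sum_distrib_left mult_ac)
qed

text \<open>Pairing with \<open>theta\<close> reads off, in the basis \<phi>, an entry of the
  first-order change of the Gram matrix when \<open>B_tilde P\<close> moves by
  \<open>mat_of w\<close>.\<close>

lemma theta_inner:
  "theta P \<phi> i j \<bullet> w = \<phi> i \<bullet> ((transpose (mat_of w) ** B_tilde P + transpose (B_tilde P) ** mat_of w) *v \<phi> j)"
  unfolding theta_def inner_add_left kron_inner matrix_vector_mult_add_rdistrib inner_add_right inner_gram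
  by (simp add: inner_commute)

lemma outer_mult: "outer u v *v w = (v \<bullet> w) *\<^sub>R u"
  by (simp add: vec_eq_iff outer_def matrix_vector_mult_def inner_vec_def sum_distrib_left mult_ac)

lemma matrix_sum_mult: "(\<Sum>i\<in>I. M i) *v x = (\<Sum>i\<in>I. M i *v x)" for M :: "'i \<Rightarrow> real ^ 'm ^ 'n"
  by (induction I rule: infinite_finite_induct) (auto simp: matrix_vector_mult_add_rdistrib)

lemma G_quadratic:
  fixes P :: "('x::finite \<times> 'y::finite) pmf"
  shows "x \<bullet> (G_mat P \<sigma> \<phi> k *v x)
    = (\<Sum>i=1..k. \<Sum>j=k+1..CARD('x). (theta P \<phi> i j \<bullet> (L_mat P *v x))\<^sup>2 / ((\<sigma> i)\<^sup>2 - (\<sigma> j)\<^sup>2))"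
  unfolding G_mat_def matrix_mul_assoc[symmetric] inner_gram
  unfolding matrix_vector_mul_assoc[symmetric] matrix_sum_mult inner_sum_right
    scaleR_matrix_vector_assoc[symmetric] outer_mult inner_scaleR_right
  by (simp add: power2_eq_square inner_commute)

lemma inner_le_spectral_norm: "x \<bullet> (A *v x) \<le> spectral_norm A * (norm x)\<^sup>2" for A :: "real ^ 'n ^ 'n"
proof -
  have "norm (A *v x) \<le> spectral_norm A * norm x"
    unfolding spectral_norm_def by (rule onorm) (rule matrix_vector_mul_bounded_linear)
  then have "norm x * norm (A *v x) \<le> norm x * (spectral_norm A * norm x)" by (intro mult_left_mono) auto
  moreover have "x \<bullet> (A *v x) \<le> norm x * norm (A *v x)" by (rule norm_cauchy_schwarz)
  ultimately show ?thesis by (simp add: power2_eq_square algebra_simps)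
qed

lemma quadratic_le_alpha:
  fixes P :: "('x::finite \<times> 'y::finite) pmf"
  shows "(\<Sum>i=1..k. \<Sum>j=k+1..CARD('x). (theta P \<phi> i j \<bullet> (L_mat P *v x))\<^sup>2 / ((\<sigma> i)\<^sup>2 - (\<sigma> j)\<^sup>2))
    \<le> alpha P \<sigma> \<phi> k * (norm x)\<^sup>2"
  unfolding G_quadratic[symmetric] alpha_def by (rule inner_le_spectral_norm)

section \<open>Linearisation of the estimator\<close>

text \<open>A vector is the sum of the images of its coordinates under the bounded linear maps
  \<open>axis i\<close>. Allowing vector coordinates lets the rule apply twice to matrices.\<close>

lemma has_derivative_vecI:
  fixes f :: "'a::real_normed_vector \<Rightarrow> 'b::euclidean_space ^ 'n"
  assumes "\<And>i. ((\<lambda>x. f x $ i) has_derivative (\<lambda>h. f' h $ i)) F"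
  shows "(f has_derivative f') F"
proof -
  have sum_axis: "(\<Sum>i\<in>UNIV. axis i (w $ i)) = w" for w :: "'b ^ 'n"
    by (simp add: vec_eq_iff axis_def)
  have lin: "bounded_linear (axis i :: 'b \<Rightarrow> 'b ^ 'n)" for i
    unfolding linear_conv_bounded_linear[symmetric]
    by (auto intro!: linearI simp: vec_eq_iff axis_def)
  have "((\<lambda>x. \<Sum>i\<in>UNIV. axis i (f x $ i)) has_derivative (\<lambda>h. \<Sum>i\<in>UNIV. axis i (f' h $ i))) F"
    by (rule has_derivative_sum) (rule bounded_linear.has_derivative[OF lin assms])
  then show ?thesis by (simp only: sum_axis)
qed

section \<open>The estimator as a differentiable function of the joint probability vector\<close>

definition row_marg :: "real ^ ('x::finite \<times> 'y::finite) \<Rightarrow> 'x \<Rightarrow> real" where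
  "row_marg q x = (\<Sum>y\<in>UNIV. q $ (x, y))"

definition col_marg :: "real ^ ('x::finite \<times> 'y::finite) \<Rightarrow> 'y \<Rightarrow> real" where
  "col_marg q y = (\<Sum>x\<in>UNIV. q $ (x, y))"

definition pmf_vec :: "'a pmf \<Rightarrow> real ^ 'a" where
  "pmf_vec P = (\<chi> a. pmf P a)"

text \<open>Extends the regular case of \<open>B_hat\<close> from distributions to all vectors, so
  that it can be differentiated.\<close>

definition B_vec :: "real ^ ('x::finite \<times> 'y::finite) \<Rightarrow> real ^ 'x ^ 'y" where
  "B_vec q = (\<chi> y x. q $ (x, y) / sqrt (row_marg q x * col_marg q y) - sqrt (row_marg q x * col_marg q y))"

lemma row_marg_pmf_vec: "row_marg (pmf_vec P) x = PX P x"
  by (simp add: row_marg_def pmf_vec_def PX_eq_sum)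

lemma col_marg_pmf_vec: "col_marg (pmf_vec P) y = PY P y"
  by (simp add: col_marg_def pmf_vec_def PY_eq_sum)

lemma B_vec_pmf_vec:
  assumes "\<And>x. PX Q x > 0" "\<And>y. PY Q y > 0"
  shows "B_hat F Q = B_vec (pmf_vec Q)"
  using assms by (simp add: B_hat_def B_vec_def row_marg_pmf_vec col_marg_pmf_vec less_imp_neq[symmetric])
    (simp add: pmf_vec_def)

lemma B_tilde_eq_B_vec:
  fixes P :: "('x::finite \<times> 'y::finite) pmf"
  assumes "\<And>x. PX P x > 0" "\<And>y. PY P y > 0"
  shows "B_tilde P = B_vec (pmf_vec P)"
proof -
  have "PX P x * PY P y / sqrt (PX P x * PY P y) = sqrt (PX P x * PY P y)" for x :: 'x and y :: 'y
    using assms(1)[of x] assms(2)[of y] by (intro real_div_sqrt) auto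
  then show ?thesis
    by (simp add: vec_eq_iff B_vec_def B_tilde_def row_marg_pmf_vec col_marg_pmf_vec diff_divide_distrib)
      (simp add: pmf_vec_def)
qed

text \<open>The derivative of \<open>B_vec\<close> at \<open>p\<close>, arranged to match the
  bracket in \<open>L_mat\<close>.\<close>

definition dB :: "real ^ ('x::finite \<times> 'y::finite) \<Rightarrow> real ^ ('x \<times> 'y) \<Rightarrow> real ^ 'x ^ 'y" where
  "dB p h = (\<chi> y x. (h $ (x, y) - 1/2 * (row_marg h x / row_marg p x + col_marg h y / col_marg p y)
      * (p $ (x, y) + row_marg p x * col_marg p y)) / sqrt (row_marg p x * col_marg p y))"

lemma vec_nth_has_derivative: "((\<lambda>q. q $ i) has_derivative (\<lambda>h. h $ i)) F"
  by (rule bounded_linear.has_derivative[OF bounded_linear_vec_nth has_derivative_ident])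

lemma row_marg_has_derivative: "((\<lambda>q. row_marg q x) has_derivative (\<lambda>h. row_marg h x)) F"
  unfolding row_marg_def by (intro has_derivative_sum vec_nth_has_derivative)

lemma col_marg_has_derivative: "((\<lambda>q. col_marg q x) has_derivative (\<lambda>h. col_marg h x)) F"
  unfolding col_marg_def by (intro has_derivative_sum vec_nth_has_derivative)

lemma has_derivative_normalised_entry:
  fixes f a b :: "'v::real_normed_vector \<Rightarrow> real"
  assumes f: "(f has_derivative f') (at p)" and a: "(a has_derivative a') (at p)" and b: "(b has_derivative b') (at p)"
    and pos: "a p > 0" "b p > 0"
  shows "((\<lambda>q. f q / sqrt (a q * b q) - sqrt (a q * b q)) has_derivative
    (\<lambda>h. (f' h - 1/2 * (a' h / a p + b' h / b p) * (f p + a p * b p)) / sqrt (a p * b p))) (at p)"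
proof -
  define c where "c = sqrt (a p * b p)"
  have c: "c > 0" "c * c = a p * b p" using pos by (auto simp: c_def)
  have sqrt: "((\<lambda>q. sqrt (a q * b q)) has_derivative (\<lambda>h. (a p * b' h + a' h * b p) * (inverse c / 2))) (at p)"
  proof -
    have "(sqrt has_real_derivative inverse c / 2) (at (a p * b p))"
      unfolding c_def using pos by (intro DERIV_real_sqrt) auto
    from has_derivative_compose[OF has_derivative_mult[OF a b] this[unfolded has_field_derivative_def]]
    show ?thesis by (simp add: mult.commute)
  qed
  have "((\<lambda>q. f q / sqrt (a q * b q) - sqrt (a q * b q)) has_derivative
     (\<lambda>h. (f' h * c - f p * ((a p * b' h + a' h * b p) * (inverse c / 2))) / (c * c)
        - (a p * b' h + a' h * b p) * (inverse c / 2))) (at p)"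
    using c pos by (intro has_derivative_diff sqrt has_derivative_divide'[OF f sqrt, folded c_def]) auto
  moreover have "(f' h * c - f p * ((a p * b' h + a' h * b p) * (inverse c / 2))) / (c * c)
        - (a p * b' h + a' h * b p) * (inverse c / 2)
     = (f' h - 1/2 * (a' h / a p + b' h / b p) * (f p + a p * b p)) / c" for h
  proof -
    \<comment> \<open>The logarithmic derivative of the product \<open>a * b\<close>, in which the
      two terms coming from the square root combine.\<close>
    define m where "m = a' h / a p + b' h / b p"
    have m: "a p * b' h + a' h * b p = (c * c) * m"
      unfolding c(2) m_def using pos by (simp add: field_simps)
    show ?thesis
      unfolding m m_def[symmetric] c(2)[symmetric] using c(1) by (simp add: field_simps)
  qed
  ultimately show ?thesis by (simp add: c_def)
qed

lemma B_vec_has_derivative: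
  assumes "\<And>x. row_marg p x > 0" "\<And>y. col_marg p y > 0"
  shows "(B_vec has_derivative dB p) (at p)"
proof (intro has_derivative_vecI)
  fix y x
  show "((\<lambda>q. B_vec q $ y $ x) has_derivative (\<lambda>h. dB p h $ y $ x)) (at p)"
    unfolding B_vec_def dB_def vec_lambda_beta
    by (rule has_derivative_normalised_entry[OF vec_nth_has_derivative row_marg_has_derivative
          col_marg_has_derivative assms])
qed

lemma gram_has_derivative:
  fixes f :: "'v::real_normed_vector \<Rightarrow> real ^ 'm ^ 'n"
  assumes f: "(f has_derivative f') (at p)"
  shows "((\<lambda>q. transpose (f q) ** f q) has_derivative
    (\<lambda>h. transpose (f' h) ** f p + transpose (f p) ** f' h)) (at p)"
proof (intro has_derivative_vecI)
  fix i j
  have e: "((\<lambda>q. f q $ y $ x) has_derivative (\<lambda>h. f' h $ y $ x)) (at p)" for x y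
    using bounded_linear.has_derivative[OF bounded_linear_vec_nth bounded_linear.has_derivative[OF bounded_linear_vec_nth f]] .
  have "((\<lambda>q. \<Sum>y\<in>UNIV. f q $ y $ i * f q $ y $ j) has_derivative
      (\<lambda>h. \<Sum>y\<in>UNIV. f p $ y $ i * f' h $ y $ j + f' h $ y $ i * f p $ y $ j)) (at p)"
    by (intro has_derivative_sum has_derivative_mult e)
  then show "((\<lambda>q. (transpose (f q) ** f q) $ i $ j) has_derivative
    (\<lambda>h. (transpose (f' h) ** f p + transpose (f p) ** f' h) $ i $ j)) (at p)"
    by (simp add: matrix_matrix_mult_def transpose_def sum.distrib add.commute)
qed

text \<open>Differentiability of the Gram matrix at \<open>P\<close> in quantitative form, as the
  bounds \<eta> and \<rho> of the perturbation argument require.\<close>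

lemma gram_expansion:
  fixes P :: "('x::finite \<times> 'y::finite) pmf"
  assumes "\<And>x. PX P x > 0" "\<And>y. PY P y > 0"
  defines "\<Delta> \<equiv> \<lambda>h. transpose (dB (pmf_vec P) h) ** B_tilde P + transpose (B_tilde P) ** dB (pmf_vec P) h"
  shows "\<exists>K>0. \<forall>h. norm (\<Delta> h) \<le> K * norm h"
    and "\<rho> > 0 \<Longrightarrow> \<exists>r>0. \<forall>q. norm (q - pmf_vec P) < r \<longrightarrow>
      norm (transpose (B_vec q) ** B_vec q - transpose (B_tilde P) ** B_tilde P - \<Delta> (q - pmf_vec P))
        \<le> \<rho> * norm (q - pmf_vec P)"
proof -
  have "(B_vec has_derivative dB (pmf_vec P)) (at (pmf_vec P))"
    using assms by (intro B_vec_has_derivative) (auto simp: row_marg_pmf_vec col_marg_pmf_vec)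
  from gram_has_derivative[OF this]
  have der: "((\<lambda>q. transpose (B_vec q) ** B_vec q) has_derivative \<Delta>) (at (pmf_vec P))"
    using assms by (simp add: \<Delta>_def B_tilde_eq_B_vec)
  show "\<exists>K>0. \<forall>h. norm (\<Delta> h) \<le> K * norm h"
    using bounded_linear.pos_bounded[OF has_derivative_bounded_linear[OF der]] by (simp add: mult.commute)
  show "\<exists>r>0. \<forall>q. norm (q - pmf_vec P) < r \<longrightarrow>
      norm (transpose (B_vec q) ** B_vec q - transpose (B_tilde P) ** B_tilde P - \<Delta> (q - pmf_vec P))
        \<le> \<rho> * norm (q - pmf_vec P)" if "\<rho> > 0"
    using der[unfolded has_derivative_at_alt] that assms by (simp add: B_tilde_eq_B_vec)
qed

lemma sum_of_bool_mult: "(\<Sum>a\<in>UNIV. of_bool (b = a) * f a) = f b"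
  for f :: "'a::finite \<Rightarrow> real"
  by (simp add: of_bool_def if_distrib[of "\<lambda>z. z * _"] cong: if_cong)

text \<open>Where \<open>P\<close> vanishes the entry is 0, because division by zero gives 0; this
  matches the sum over the support in \<open>chi2\<close>.\<close>

definition std_dev :: "'a pmf \<Rightarrow> 'a pmf \<Rightarrow> real ^ 'a" where
  "std_dev P Q = (\<chi> a. (pmf Q a - pmf P a) / sqrt (pmf P a))"

lemma norm_std_dev: "(norm (std_dev P Q))\<^sup>2 = chi2 Q P" for P Q :: "'a::finite pmf"
proof -
  have "(norm (std_dev P Q))\<^sup>2 = (\<Sum>a\<in>UNIV. (pmf Q a - pmf P a)\<^sup>2 / pmf P a)"
    unfolding power2_norm_eq_inner inner_vec_def
    by (simp add: std_dev_def power2_eq_square)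
  also have "\<dots> = chi2 Q P"
    unfolding chi2_def by (intro sum.mono_neutral_right) (auto simp: set_pmf_iff)
  finally show ?thesis .
qed

text \<open>The column factors \<open>sqrt (pmf P (x', y'))\<close> of \<open>L_mat\<close> undo the
  standardisation. At zeros of \<open>P\<close> nothing is lost, since \<open>Q\<close> vanishes
  there too.\<close>

lemma mat_of_L_mat:
  fixes P Q :: "('x::finite \<times> 'y::finite) pmf"
  assumes "set_pmf Q \<subseteq> set_pmf P"
  shows "mat_of (L_mat P *v std_dev P Q) = dB (pmf_vec P) (pmf_vec Q - pmf_vec P)"
proof -
  define h where "h = pmf_vec Q - pmf_vec P"
  have sc: "sqrt (pmf P a) * std_dev P Q $ a = h $ a" for a
    using assms by (cases a, cases "a \<in> set_pmf P") (auto simp: std_dev_def h_def pmf_vec_def set_pmf_iff subset_iff)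
  have "(L_mat P *v std_dev P Q) $ (x, y) = dB (pmf_vec P) h $ y $ x" for x y
  proof -
    define s where "s = sqrt (PX P x * PY P y)"
    define c where "c = 1/2 * (pmf P (x, y) + PX P x * PY P y)"
    have entry: "e / f * (u * v - 1/2 * (u / a + v / b) * m) * z
      = (u * (v * (e * z)) - u * (e * z * (1/2 * m / a)) - v * (e * z * (1/2 * m / b))) / f"
      for e f u v a b m z :: real
      by (simp only: divide_inverse algebra_simps)
    \<comment> \<open>The Kronecker deltas select a single entry, a row marginal and a column
      marginal.\<close>
    have sums: "(\<Sum>x'\<in>UNIV. \<Sum>y'\<in>UNIV. of_bool (x = x') * (of_bool (y = y') * h $ (x', y'))) = h $ (x, y)"
      "(\<Sum>x'\<in>UNIV. \<Sum>y'\<in>UNIV. of_bool (x = x') * (h $ (x', y') * (c / PX P x))) = row_marg h x * (c / PX P x)"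
      "(\<Sum>x'\<in>UNIV. \<Sum>y'\<in>UNIV. of_bool (y = y') * (h $ (x', y') * (c / PY P y))) = col_marg h y * (c / PY P y)"
      unfolding sum_distrib_left[symmetric] sum_of_bool_mult row_marg_def col_marg_def
      by (simp_all only: sum_distrib_right)
    have "(L_mat P *v std_dev P Q) $ (x, y) = (\<Sum>x'\<in>UNIV. \<Sum>y'\<in>UNIV.
         (of_bool (x = x') * (of_bool (y = y') * h $ (x', y')) - of_bool (x = x') * (h $ (x', y') * (c / PX P x))
           - of_bool (y = y') * (h $ (x', y') * (c / PY P y))) / s)"
      unfolding matrix_vector_mult_def sum_prod_UNIV L_mat_def vec_lambda_beta split sc[symmetric] s_def c_def real_sqrt_divide
      by (intro sum.cong refl entry)
    also have "\<dots> = (h $ (x, y) - row_marg h x * (c / PX P x) - col_marg h y * (c / PY P y)) / s"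
      unfolding sum_divide_distrib[symmetric] sum_subtractf sums ..
    also have "\<dots> = dB (pmf_vec P) h $ y $ x"
      unfolding dB_def vec_lambda_beta row_marg_pmf_vec col_marg_pmf_vec s_def c_def
      by (simp only: pmf_vec_def vec_lambda_beta divide_inverse algebra_simps)
    finally show ?thesis .
  qed
  then show ?thesis
    unfolding mat_of_def h_def[symmetric] by (simp only: vec_eq_iff vec_lambda_beta simp_thms)
qed

section \<open>A lower bound for the spectral norm\<close>

context
  fixes P :: "('x::finite \<times> 'y::finite) pmf"
  assumes PX_pos: "\<And>x. PX P x > 0" and PY_pos: "\<And>y. PY P y > 0"
begin

definition sqrt_PX :: "real ^ 'x" where
  "sqrt_PX = (\<chi> x. sqrt (PX P x))"

definition sqrt_PY :: "real ^ 'y" where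
  "sqrt_PY = (\<chi> y. sqrt (PY P y))"

lemma sum_PX: "(\<Sum>x\<in>UNIV. PX P x) = 1" and sum_PY: "(\<Sum>y\<in>UNIV. PY P y) = 1"
  by (intro sum_pmf_eq_1; simp)+

lemma B_tilde_entry: "B_tilde P $ y $ x = pmf P (x, y) / (sqrt (PX P x) * sqrt (PY P y)) - sqrt (PX P x) * sqrt (PY P y)"
  using PX_pos[of x] PY_pos[of y]
  by (simp add: B_tilde_def real_sqrt_mult divide_simps) (simp add: algebra_simps)

text \<open>Weighted by \<open>sqrt_PX\<close>, the joint and the product part of a row both sum to
  \<open>sqrt (PY P y)\<close> and cancel.\<close>

lemma B_tilde_sqrt_PX: "B_tilde P *v sqrt_PX = 0"
proof -
  have "(\<Sum>x\<in>UNIV. B_tilde P $ y $ x * sqrt (PX P x)) = 0" for y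
  proof -
    have "(\<Sum>x\<in>UNIV. B_tilde P $ y $ x * sqrt (PX P x)) = (\<Sum>x\<in>UNIV. pmf P (x, y) / sqrt (PY P y) - PX P x * sqrt (PY P y))"
    proof (intro sum.cong refl)
      fix x
      show "B_tilde P $ y $ x * sqrt (PX P x) = pmf P (x, y) / sqrt (PY P y) - PX P x * sqrt (PY P y)"
        using PX_pos[of x] PY_pos[of y] by (simp add: B_tilde_entry left_diff_distrib)
    qed
    also have "\<dots> = PY P y / sqrt (PY P y) - sqrt (PY P y)"
      by (simp add: sum_subtractf sum_divide_distrib[symmetric] sum_distrib_right[symmetric] PY_eq_sum[symmetric] sum_PX)
    finally show ?thesis using PY_pos[of y] by (simp add: real_div_sqrt)
  qed
  then show ?thesis by (simp add: vec_eq_iff matrix_vector_mult_def sqrt_PX_def)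
qed

lemma sqrt_PY_B_tilde: "sqrt_PY \<bullet> (B_tilde P *v z) = 0"
proof -
  have "(\<Sum>y\<in>UNIV. B_tilde P $ y $ x * sqrt (PY P y)) = 0" for x
  proof -
    have "(\<Sum>y\<in>UNIV. B_tilde P $ y $ x * sqrt (PY P y)) = (\<Sum>y\<in>UNIV. pmf P (x, y) / sqrt (PX P x) - PY P y * sqrt (PX P x))"
    proof (intro sum.cong refl)
      fix y
      show "B_tilde P $ y $ x * sqrt (PY P y) = pmf P (x, y) / sqrt (PX P x) - PY P y * sqrt (PX P x)"
        using PX_pos[of x] PY_pos[of y] by (simp add: B_tilde_entry left_diff_distrib)
    qed
    also have "\<dots> = PX P x / sqrt (PX P x) - sqrt (PX P x)"
      by (simp add: sum_subtractf sum_divide_distrib[symmetric] sum_distrib_right[symmetric] PX_eq_sum[symmetric] sum_PY)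
    finally show ?thesis using PX_pos[of x] by (simp add: real_div_sqrt)
  qed
  then have "transpose (B_tilde P) *v sqrt_PY = 0"
    by (simp add: vec_eq_iff matrix_vector_mult_def transpose_def sqrt_PY_def del: transpose_matrix_vector)
  then show ?thesis by (simp add: dot_lmul_matrix[symmetric])
qed

text \<open>Only the dependence of \<open>L\<close> on the \<open>x\<close>-marginal survives against \<open>sqrt PX\<close>, because
  \<open>B_tilde \<phi>\<close> is orthogonal to \<open>sqrt PY\<close>.\<close>

lemma transpose_L_mat_kron:
  assumes eig: "(transpose (B_tilde P) ** B_tilde P) *v u = \<nu> *\<^sub>R u"
  shows "transpose (L_mat P) *v kron sqrt_PX (B_tilde P *v u)
    = (\<chi> p. - 1/2 * \<nu> * u $ fst p * sqrt (pmf P p / PX P (fst p)))"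
proof -
  define \<psi> where "\<psi> = B_tilde P *v u"
  have "(\<Sum>x\<in>UNIV. \<Sum>y\<in>UNIV. L_mat P $ (x, y) $ (a, b) * (sqrt (PX P x) * \<psi> $ y))
     = - 1/2 * \<nu> * u $ a * sqrt (pmf P (a, b) / PX P a)" for a b
  proof -
    define q where "q = sqrt (pmf P (a, b))"
    have entry: "L_mat P $ (x, y) $ (a, b) * (sqrt (PX P x) * \<psi> $ y)
      = q * (of_bool (a = x) * (of_bool (b = y) * (\<psi> $ y / sqrt (PY P y)))
        - 1/2 * (of_bool (a = x) * (\<psi> $ y * sqrt (PX P x) * (B_tilde P $ y $ x + 2 * sqrt (PX P x) * sqrt (PY P y)) / PX P x))
        - 1/2 * (of_bool (b = y) * ((pmf P (x, y) + PX P x * PY P y) * (\<psi> $ y / sqrt (PY P y) / PY P y))))" for x y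
    proof -
      have "B_tilde P $ y $ x + 2 * sqrt (PX P x) * sqrt (PY P y) = (pmf P (x, y) + PX P x * PY P y) / (sqrt (PX P x) * sqrt (PY P y))"
        using PX_pos[of x] PY_pos[of y] by (simp add: B_tilde_entry divide_simps)
      then have T: "\<psi> $ y * sqrt (PX P x) * (B_tilde P $ y $ x + 2 * sqrt (PX P x) * sqrt (PY P y)) / PX P x
          = \<psi> $ y * (pmf P (x, y) + PX P x * PY P y) / sqrt (PY P y) / PX P x"
        using PX_pos[of x] by simp
      have scale: "e / (f * g) * (s * t - 1/2 * (s / A + t / C) * m) * (f * z)
          = e * (s * (t * (z / g)) - 1/2 * (s * (z * m / g / A)) - 1/2 * (t * (m * (z / g / C))))"
        if "f \<noteq> 0" for e f g s t A C m z :: real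
      proof -
        have "e / (f * g) * (s * t - 1/2 * (s / A + t / C) * m) * (f * z) = e / g * (s * t - 1/2 * (s / A + t / C) * m) * z"
          using that by simp
        then show ?thesis by (simp only: divide_inverse algebra_simps)
      qed
      show ?thesis
        unfolding T L_mat_def vec_lambda_beta split q_def real_sqrt_divide real_sqrt_mult
          eq_commute[of x a] eq_commute[of y b]
        using PX_pos[of x] by (intro scale) simp
    qed
    have BT: "(\<Sum>y\<in>UNIV. \<psi> $ y * B_tilde P $ y $ a) = \<nu> * u $ a"
      using arg_cong[OF eig, of "\<lambda>w. w $ a"]
      by (simp add: matrix_vector_mul_assoc[symmetric] \<psi>_def[symmetric] del: transpose_matrix_vector)
         (simp add: matrix_vector_mult_def transpose_def mult.commute)
    have orth: "(\<Sum>y\<in>UNIV. \<psi> $ y * sqrt (PY P y)) = 0"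
      using sqrt_PY_B_tilde[of u] by (simp add: \<psi>_def[symmetric] inner_vec_def sqrt_PY_def mult.commute)
    have s1: "(\<Sum>x\<in>UNIV. \<Sum>y\<in>UNIV. of_bool (a = x) * (of_bool (b = y) * (\<psi> $ y / sqrt (PY P y)))) = \<psi> $ b / sqrt (PY P b)"
      unfolding sum_distrib_left[symmetric] sum_of_bool_mult ..
    have s2: "(\<Sum>x\<in>UNIV. \<Sum>y\<in>UNIV. of_bool (a = x) * (\<psi> $ y * sqrt (PX P x) * (B_tilde P $ y $ x + 2 * sqrt (PX P x) * sqrt (PY P y)) / PX P x))
       = \<nu> * u $ a * sqrt (PX P a) / PX P a"
    proof -
      have "(\<Sum>x\<in>UNIV. \<Sum>y\<in>UNIV. of_bool (a = x) * (\<psi> $ y * sqrt (PX P x) * (B_tilde P $ y $ x + 2 * sqrt (PX P x) * sqrt (PY P y)) / PX P x))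
         = (\<Sum>y\<in>UNIV. \<psi> $ y * sqrt (PX P a) * (B_tilde P $ y $ a + 2 * sqrt (PX P a) * sqrt (PY P y)) / PX P a)"
        unfolding sum_distrib_left[symmetric] by (simp add: of_bool_def if_distrib[of "\<lambda>z. z * _"] cong: if_cong)
      also have "\<dots> = (\<Sum>y\<in>UNIV. \<psi> $ y * B_tilde P $ y $ a) * (sqrt (PX P a) / PX P a) + 2 * (\<Sum>y\<in>UNIV. \<psi> $ y * sqrt (PY P y))"
        unfolding sum_distrib_left sum_distrib_right sum.distrib[symmetric]
        using PX_pos[of a] by (intro sum.cong refl) (simp add: field_simps)
      finally show ?thesis by (simp add: BT orth)
    qed
    have s3: "(\<Sum>x\<in>UNIV. \<Sum>y\<in>UNIV. of_bool (b = y) * ((pmf P (x, y) + PX P x * PY P y) * (\<psi> $ y / sqrt (PY P y) / PY P y)))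
       = 2 * (\<psi> $ b / sqrt (PY P b))"
    proof -
      have "(\<Sum>x\<in>UNIV. \<Sum>y\<in>UNIV. of_bool (b = y) * ((pmf P (x, y) + PX P x * PY P y) * (\<psi> $ y / sqrt (PY P y) / PY P y)))
        = (\<Sum>x\<in>UNIV. pmf P (x, b) + PX P x * PY P b) * (\<psi> $ b / sqrt (PY P b) / PY P b)"
        unfolding sum_of_bool_mult sum_distrib_right ..
      also have "(\<Sum>x\<in>UNIV. pmf P (x, b) + PX P x * PY P b) = 2 * PY P b"
        by (simp add: sum.distrib sum_distrib_right[symmetric] PY_eq_sum[symmetric] sum_PX)
      finally show ?thesis using PY_pos[of b] by simp
    qed
    \<comment> \<open>The sum \<open>s1\<close> cancels against half of \<open>s3\<close>, so only
      the contribution \<open>s2\<close> of the x-marginal is left.\<close>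
    have "(\<Sum>x\<in>UNIV. \<Sum>y\<in>UNIV. L_mat P $ (x, y) $ (a, b) * (sqrt (PX P x) * \<psi> $ y))
      = q * (- 1/2 * (\<nu> * u $ a * sqrt (PX P a) / PX P a))"
    proof -
      have "(\<Sum>x\<in>UNIV. \<Sum>y\<in>UNIV. q * (X x y - 1/2 * Y x y - 1/2 * Z x y))
        = q * ((\<Sum>x\<in>UNIV. \<Sum>y\<in>UNIV. X x y) - 1/2 * (\<Sum>x\<in>UNIV. \<Sum>y\<in>UNIV. Y x y) - 1/2 * (\<Sum>x\<in>UNIV. \<Sum>y\<in>UNIV. Z x y))"
        for X Y Z :: "'x \<Rightarrow> 'y \<Rightarrow> real"
        by (simp only: sum_subtractf sum_distrib_left right_diff_distrib)
      then show ?thesis unfolding entry by (simp only: s1 s2 s3) simp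
    qed
    also have "\<nu> * u $ a * sqrt (PX P a) / PX P a = \<nu> * u $ a / sqrt (PX P a)"
    proof -
      have inv: "sqrt (PX P a) / PX P a = 1 / sqrt (PX P a)"
        using PX_pos[of a] by (simp add: divide_simps)
      show ?thesis unfolding times_divide_eq_right[symmetric] inv by simp
    qed
    also have "q * (- 1/2 * (\<nu> * u $ a / sqrt (PX P a))) = - 1/2 * \<nu> * u $ a * sqrt (pmf P (a, b) / PX P a)"
      by (simp add: q_def real_sqrt_divide)
    finally show ?thesis .
  qed
  then show ?thesis
    unfolding \<psi>_def[symmetric]
    by (simp add: vec_eq_iff matrix_vector_mult_def transpose_def sum_prod_UNIV kron_def sqrt_PX_def
        del: transpose_matrix_vector)
qed

text \<open>In the squared norm of the explicit vector, the conditional probabilities given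
  \<open>x\<close> sum to one.\<close>

lemma norm_transpose_L_mat_kron:
  assumes eig: "(transpose (B_tilde P) ** B_tilde P) *v u = \<nu> *\<^sub>R u"
  shows "(norm (transpose (L_mat P) *v kron sqrt_PX (B_tilde P *v u)))\<^sup>2 = \<nu>\<^sup>2 / 4 * (norm u)\<^sup>2"
proof -
  have "(norm (transpose (L_mat P) *v kron sqrt_PX (B_tilde P *v u)))\<^sup>2
    = (\<Sum>x\<in>UNIV. \<Sum>y\<in>UNIV. (- 1/2 * \<nu> * u $ x * sqrt (pmf P (x, y) / PX P x))\<^sup>2)"
    unfolding transpose_L_mat_kron[OF eig] power2_norm_eq_inner inner_vec_def sum_prod_UNIV
    by (simp add: power2_eq_square)
  also have "\<dots> = (\<Sum>x\<in>UNIV. \<nu>\<^sup>2 / 4 * (u $ x)\<^sup>2 * ((\<Sum>y\<in>UNIV. pmf P (x, y)) / PX P x))"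
    unfolding sum_distrib_left sum_divide_distrib
    by (intro sum.cong refl) (simp add: power_mult_distrib power_divide)
  also have "\<dots> = (\<Sum>x\<in>UNIV. \<nu>\<^sup>2 / 4 * (u $ x)\<^sup>2)"
    using PX_pos by (simp add: PX_eq_sum[symmetric] less_imp_neq[symmetric])
  also have "\<dots> = \<nu>\<^sup>2 / 4 * (norm u)\<^sup>2"
    unfolding power2_norm_eq_inner inner_vec_def by (simp add: power2_eq_square sum_distrib_left)
  finally show ?thesis .
qed

text \<open>The witness is \<open>L\<^sup>T (sqrt PX \<otimes> B_tilde \<phi>\<^sub>1)\<close>: the vector \<open>sqrt PX\<close> lies in the kernel of
  \<open>B_tilde\<close>, hence in the span of the \<open>\<phi>\<^sub>j\<close> with \<open>j > k\<close>.\<close>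

lemma alpha_ge:
  assumes sys: "right_singular_system (B_tilde P) \<sigma> \<phi>"
    and k: "1 \<le> k" "k < CARD('x)" and gap: "\<sigma> (k + 1) < \<sigma> k"
  shows "(\<sigma> 1)\<^sup>2 / 4 \<le> alpha P \<sigma> \<phi> k"
proof -
  note D = right_singular_systemD[OF sys]
  define b where "b j = sqrt_PX \<bullet> \<phi> j" for j
  define w where "w = kron sqrt_PX (B_tilde P *v \<phi> 1)"
  define v where "v = transpose (L_mat P) *v w"
  have order: "0 \<le> \<sigma> (k+1)" "\<And>i. i \<in> {1..k} \<Longrightarrow> \<sigma> k \<le> \<sigma> i" "\<And>j. j \<in> {k+1..CARD('x)} \<Longrightarrow> \<sigma> j \<le> \<sigma> (k+1) \<and> 0 \<le> \<sigma> j"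
    using D(1,2) k by auto
  have \<sigma>1: "0 < \<sigma> 1" using order(1) order(2)[of 1] gap k by auto
  \<comment> \<open>The gap makes the first \<open>k\<close> singular values positive, and
    eigenvectors with nonzero eigenvalue are orthogonal to the kernel.\<close>
  have b0: "b i = 0" if "i \<in> {1..k}" for i
  proof -
    have i: "i \<in> {1..CARD('x)}" "\<sigma> i > 0" using that k order(1) order(2)[OF that] gap by auto
    have "(\<sigma> i)\<^sup>2 * b i = sqrt_PX \<bullet> ((transpose (B_tilde P) ** B_tilde P) *v \<phi> i)"
      unfolding D(4)[OF i(1)] b_def by simp
    also have "\<dots> = 0" unfolding inner_gram B_tilde_sqrt_PX by simp
    finally show ?thesis using i by simp
  qed
  have split: "(\<Sum>j=1..CARD('x). f j) = (\<Sum>j=1..k. f j) + (\<Sum>j=k+1..CARD('x). f j)" for f :: "nat \<Rightarrow> 'b::comm_monoid_add"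
    using sum.ub_add_nat[of 1 k f "CARD('x) - k"] k by simp
  have expand: "(\<Sum>j=k+1..CARD('x). b j *\<^sub>R \<phi> j) = sqrt_PX"
  proof -
    have "(\<Sum>j=1..CARD('x). b j *\<^sub>R \<phi> j) = sqrt_PX"
      unfolding b_def by (rule orthonormal_family_expansion[OF D(3)])
    moreover have "(\<Sum>j=1..k. b j *\<^sub>R \<phi> j) = 0" using b0 by (intro sum.neutral) auto
    ultimately show ?thesis unfolding split by simp
  qed
  have b_sq: "(\<Sum>j=k+1..CARD('x). (b j)\<^sup>2) = 1"
  proof -
    have "(\<Sum>j=1..CARD('x). (b j)\<^sup>2) = sqrt_PX \<bullet> sqrt_PX"
      unfolding b_def power2_eq_square by (rule orthonormal_family_parseval[OF D(3)])
    also have "\<dots> = 1" by (simp add: inner_vec_def sqrt_PX_def sum_PX)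
    finally have "(\<Sum>j=1..CARD('x). (b j)\<^sup>2) = 1" .
    moreover have "(\<Sum>j=1..k. (b j)\<^sup>2) = 0" using b0 by (intro sum.neutral) auto
    ultimately show ?thesis unfolding split by simp
  qed
  \<comment> \<open>Summing with the weights \<open>b j\<close> turns \<open>\<phi> j\<close> into
    \<open>sqrt_PX\<close>. One Kronecker term becomes \<open>w\<close>; the other vanishes because
    \<open>B_tilde P\<close> annihilates \<open>sqrt_PX\<close>.\<close>
  have "(\<Sum>j=k+1..CARD('x). b j * (theta P \<phi> 1 j \<bullet> z)) = w \<bullet> z" for z
  proof -
    have "(\<Sum>j=k+1..CARD('x). b j * (theta P \<phi> 1 j \<bullet> z))
      = (B_tilde P *v \<phi> 1) \<bullet> (mat_of z *v (\<Sum>j=k+1..CARD('x). b j *\<^sub>R \<phi> j))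
        + (B_tilde P *v (\<Sum>j=k+1..CARD('x). b j *\<^sub>R \<phi> j)) \<bullet> (mat_of z *v \<phi> 1)"
      unfolding theta_def inner_add_left kron_inner
      by (simp add: linear_sum[OF matrix_vector_mul_linear] inner_sum_right inner_sum_left
        matrix_vector_mult_scaleR sum.distrib algebra_simps)
    then show ?thesis
      unfolding expand B_tilde_sqrt_PX w_def kron_inner by simp
  qed
  then have wLv: "(\<Sum>j=k+1..CARD('x). b j * (theta P \<phi> 1 j \<bullet> (L_mat P *v v))) = (norm v)\<^sup>2"
    by (simp add: v_def power2_norm_eq_inner dot_lmul_matrix)
  have nv: "(norm v)\<^sup>2 = ((\<sigma> 1)\<^sup>2)\<^sup>2 / 4"
  proof -
    have "norm (\<phi> 1) = 1" using D(3)[of 1 1] k by (simp add: norm_eq_1)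
    then show ?thesis
      unfolding v_def w_def using norm_transpose_L_mat_kron[OF D(4)[of 1]] k by simp
  qed
  \<comment> \<open>Cauchy-Schwarz against the unit weights \<open>b\<close> produces the terms with
    \<open>i = 1\<close> of the quadratic form. Enlarging their denominators to the square of
    \<open>\<sigma> 1\<close> and dropping the nonnegative terms with other \<open>i\<close> gives a
    lower bound for that form.\<close>
  have "((norm v)\<^sup>2)\<^sup>2 \<le> (\<Sum>j=k+1..CARD('x). (b j)\<^sup>2) * (\<Sum>j=k+1..CARD('x). (theta P \<phi> 1 j \<bullet> (L_mat P *v v))\<^sup>2)"
    unfolding wLv[symmetric] by (rule Cauchy_Schwarz_ineq_sum)
  also have "\<dots> = (\<sigma> 1)\<^sup>2 * (\<Sum>j=k+1..CARD('x). (theta P \<phi> 1 j \<bullet> (L_mat P *v v))\<^sup>2 / (\<sigma> 1)\<^sup>2)"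
    unfolding b_sq using \<sigma>1 by (simp add: sum_divide_distrib[symmetric])
  also have "(\<Sum>j=k+1..CARD('x). (theta P \<phi> 1 j \<bullet> (L_mat P *v v))\<^sup>2 / (\<sigma> 1)\<^sup>2)
      \<le> (\<Sum>i=1..k. \<Sum>j=k+1..CARD('x). (theta P \<phi> i j \<bullet> (L_mat P *v v))\<^sup>2 / ((\<sigma> i)\<^sup>2 - (\<sigma> j)\<^sup>2))"
  proof -
    have pos: "0 < (\<sigma> i)\<^sup>2 - (\<sigma> j)\<^sup>2" if "i \<in> {1..k}" "j \<in> {k+1..CARD('x)}" for i j
      using order(2)[OF that(1)] order(3)[OF that(2)] gap by (simp add: power_strict_mono)
    have "(\<Sum>j=k+1..CARD('x). (theta P \<phi> 1 j \<bullet> (L_mat P *v v))\<^sup>2 / (\<sigma> 1)\<^sup>2)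
       \<le> (\<Sum>j=k+1..CARD('x). (theta P \<phi> 1 j \<bullet> (L_mat P *v v))\<^sup>2 / ((\<sigma> 1)\<^sup>2 - (\<sigma> j)\<^sup>2))"
      using pos[of 1] k \<sigma>1 by (intro sum_mono divide_left_mono mult_pos_pos) auto
    also have "\<dots> \<le> (\<Sum>i=1..k. \<Sum>j=k+1..CARD('x). (theta P \<phi> i j \<bullet> (L_mat P *v v))\<^sup>2 / ((\<sigma> i)\<^sup>2 - (\<sigma> j)\<^sup>2))"
      using k pos
      by (intro member_le_sum[of 1 "{1..k}" "\<lambda>i. \<Sum>j=k+1..CARD('x). (theta P \<phi> i j \<bullet> (L_mat P *v v))\<^sup>2 / ((\<sigma> i)\<^sup>2 - (\<sigma> j)\<^sup>2)"])
         (auto intro!: sum_nonneg divide_nonneg_pos)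
    finally show ?thesis .
  qed
  also have "\<dots> \<le> alpha P \<sigma> \<phi> k * (norm v)\<^sup>2" by (rule quadratic_le_alpha)
  finally have "((norm v)\<^sup>2)\<^sup>2 \<le> (\<sigma> 1)\<^sup>2 * (alpha P \<sigma> \<phi> k * (norm v)\<^sup>2)"
    using \<sigma>1 by (simp add: mult_left_mono)
  then have "(norm v)\<^sup>2 * (norm v)\<^sup>2 \<le> ((\<sigma> 1)\<^sup>2 * alpha P \<sigma> \<phi> k) * (norm v)\<^sup>2"
    by (simp only: power2_eq_square[of "(norm v)\<^sup>2"] mult.assoc)
  moreover have "(norm v)\<^sup>2 > 0" unfolding nv using \<sigma>1 by simp
  ultimately have "(norm v)\<^sup>2 \<le> (\<sigma> 1)\<^sup>2 * alpha P \<sigma> \<phi> k" by (rule mult_right_le_imp_le)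
  then have "(\<sigma> 1)\<^sup>2 * ((\<sigma> 1)\<^sup>2 / 4) \<le> (\<sigma> 1)\<^sup>2 * alpha P \<sigma> \<phi> k"
    unfolding nv by (simp add: power2_eq_square)
  then show ?thesis by (rule mult_left_le_imp_le) (use \<sigma>1 in simp)
qed

end

section \<open>Tail bound\<close>

text \<open>The tangent of the logarithm at \<open>4 * a\<close> has slope
  \<open>1 / (4 * a)\<close>, so \<open>a * ln (n + 1)\<close> costs a linear term
  \<open>n / 4\<close>, which is the surplus left by the factor \<open>5/4\<close>. The hypothesis
  \<open>\<epsilon> \<le> t\<close> ensures \<open>1 \<le> a\<close>.\<close>

lemma N_bound_suffices:
  assumes t: "\<epsilon> \<le> t" "0 < \<epsilon>" and m: "1 \<le> m" and \<delta>: "0 < \<delta>" "\<delta> < 1"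
    and n: "real n > N_bound t m \<epsilon> \<delta>"
  shows "n > 0" and "(real n + 1) ^ m * exp (- real n * (5/4 * \<epsilon> / t)) < \<delta>"
proof -
  define a where "a = t * m / \<epsilon>"
  have t0: "0 < t" using t by simp
  have a: "1 \<le> a"
  proof -
    have "\<epsilon> * 1 \<le> t * m" using t m by (intro mult_mono) auto
    then show ?thesis using t by (simp add: a_def)
  qed
  have N: "N_bound t m \<epsilon> \<delta> = a * ln (6 * a) + t / \<epsilon> * ln (1 / \<delta>)"
    by (simp add: N_bound_def a_def mult.assoc)
  have "0 \<le> N_bound t m \<epsilon> \<delta>"
    unfolding N using a t t0 \<delta> by (intro add_nonneg_nonneg mult_nonneg_nonneg ln_ge_zero) auto
  then show "n > 0" using n by (metis gr0I leD of_nat_0)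
  have "ln (real n + 1) = ln ((real n + 1) / (4 * a)) + ln (4 * a)"
    using a by (simp add: ln_div)
  also have "\<dots> \<le> ((real n + 1) / (4 * a) - 1) + ln (6 * a)"
    using a by (intro add_mono ln_le_minus_one) auto
  finally have "a * ln (real n + 1) \<le> a * (((real n + 1) / (4 * a) - 1) + ln (6 * a))"
    using a by (intro mult_left_mono) auto
  also have "\<dots> = (real n + 1) / 4 - a + a * ln (6 * a)"
    using a by (simp add: field_simps)
  finally have "a * ln (real n + 1) \<le> (real n + 1) / 4 - a + a * ln (6 * a)" .
  moreover have "ln (1 / \<delta>) = - ln \<delta>" using \<delta> by (simp add: ln_div)
  then have "a * ln (6 * a) - t / \<epsilon> * ln \<delta> < real n" using n unfolding N by simp
  \<comment> \<open>The leftover \<open>1/4\<close> is absorbed by \<open>- a\<close>.\<close>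
  ultimately have "a * ln (real n + 1) < 5/4 * real n + t / \<epsilon> * ln \<delta>"
    using a by argo
  then have "\<epsilon> / t * (a * ln (real n + 1)) < \<epsilon> / t * (5/4 * real n + t / \<epsilon> * ln \<delta>)"
    using t t0 by (intro mult_strict_left_mono) auto
  moreover have "\<epsilon> / t * (a * ln (real n + 1)) = m * ln (real n + 1)"
    using t t0 by (simp add: a_def)
  moreover have "\<epsilon> / t * (5/4 * real n + t / \<epsilon> * ln \<delta>) = real n * (5/4 * \<epsilon> / t) + ln \<delta>"
    using t t0 by (simp add: field_simps)
  ultimately have "m * ln (real n + 1) - real n * (5/4 * \<epsilon> / t) < ln \<delta>" by linarith
  then have "exp (m * ln (real n + 1) - real n * (5/4 * \<epsilon> / t)) < exp (ln \<delta>)" by simp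
  moreover have "exp (m * ln (real n + 1) - real n * (5/4 * \<epsilon> / t)) = (real n + 1) ^ m * exp (- real n * (5/4 * \<epsilon> / t))"
  proof -
    have "(real n + 1) ^ m = exp (m * ln (real n + 1))" by (simp add: exp_of_nat_mult)
    then show ?thesis by (simp add: mult_exp_exp)
  qed
  ultimately show "(real n + 1) ^ m * exp (- real n * (5/4 * \<epsilon> / t)) < \<delta>" using \<delta> by simp
qed

section \<open>Bounds uniform over the choice of singular system\<close>

lemma singular_values_unique:
  fixes A :: "real ^ 'm ^ 'n"
  assumes sys: "right_singular_system A \<sigma> \<phi>" and sys': "right_singular_system A s v" and i: "i \<in> {1..CARD('m)}"
  shows "\<exists>c\<in>{1..CARD('m)}. (\<sigma> i)\<^sup>2 = (s c)\<^sup>2"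
proof -
  note D = right_singular_systemD[OF sys] and D' = right_singular_systemD[OF sys']
  have "(\<Sum>c=1..CARD('m). (\<phi> i \<bullet> v c) * (\<phi> i \<bullet> v c)) = 1"
    using orthonormal_family_parseval[OF D'(3), of "\<phi> i" "\<phi> i"] D(3)[OF i i] by simp
  \<comment> \<open>A unit vector cannot be orthogonal to the whole basis \<open>v\<close>. Symmetry
    of the Gram matrix then equates the two eigenvalues across the nonzero overlap.\<close>
  then obtain c where c: "c \<in> {1..CARD('m)}" "\<phi> i \<bullet> v c \<noteq> 0"
    by (metis (mono_tags, lifting) mult_zero_left sum.neutral zero_neq_one)
  have "(\<sigma> i)\<^sup>2 * (\<phi> i \<bullet> v c) = v c \<bullet> ((transpose A ** A) *v \<phi> i)"
    unfolding D(4)[OF i] by (simp add: inner_commute)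
  also have "\<dots> = \<phi> i \<bullet> ((transpose A ** A) *v v c)"
    unfolding inner_gram by (rule inner_commute)
  also have "\<dots> = (s c)\<^sup>2 * (\<phi> i \<bullet> v c)"
    unfolding D'(4)[OF c(1)] by simp
  finally show ?thesis using c by auto
qed

text \<open>The threshold on \<epsilon> may depend on \<open>P\<close> only. All squared singular
  values lie in one finite set fixed by a single system, so the positive differences have a positive
  minimum.\<close>

lemma uniform_gap:
  fixes A :: "real ^ 'm ^ 'n"
  shows "\<exists>g>0. \<forall>\<sigma> \<phi> k. right_singular_system A \<sigma> \<phi> \<longrightarrow> 1 \<le> k \<longrightarrow> k < CARD('m) \<longrightarrow> \<sigma> (k + 1) < \<sigma> k
    \<longrightarrow> g \<le> (\<sigma> k)\<^sup>2 - (\<sigma> (k + 1))\<^sup>2"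
proof (cases "\<exists>s v. right_singular_system A s v")
  case True
  then obtain s v where sys': "right_singular_system A s v" by blast
  define S where "S = (\<lambda>c. (s c)\<^sup>2) ` {1..CARD('m)}"
  \<comment> \<open>Inserting 1 keeps the set nonempty when all singular values agree.\<close>
  define T where "T = insert 1 {x \<in> (\<lambda>(a, b). a - b) ` (S \<times> S). 0 < x}"
  have fin: "finite T" by (simp add: T_def S_def)
  have "0 < Min T" using fin by (subst Min_gr_iff) (auto simp: T_def)
  moreover have "Min T \<le> (\<sigma> k)\<^sup>2 - (\<sigma> (k + 1))\<^sup>2"
    if sys: "right_singular_system A \<sigma> \<phi>" and k: "1 \<le> k" "k < CARD('m)" "\<sigma> (k + 1) < \<sigma> k" for \<sigma> \<phi> k
  proof (rule Min_le[OF fin])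
    have "(\<sigma> k)\<^sup>2 \<in> S" "(\<sigma> (k+1))\<^sup>2 \<in> S"
      using singular_values_unique[OF sys sys'] k by (force simp: S_def)+
    moreover have "(\<sigma> (k+1))\<^sup>2 < (\<sigma> k)\<^sup>2"
      using right_singular_systemD(1)[OF sys, of "k+1"] k by (intro power_strict_mono) auto
    ultimately show "(\<sigma> k)\<^sup>2 - (\<sigma> (k + 1))\<^sup>2 \<in> T" unfolding T_def by force
  qed
  ultimately show ?thesis by blast
qed (auto intro: exI[of _ 1])

text \<open>Replaces a singular value by a quantity that does not refer to the chosen singular
  system.\<close>

lemma singular_value_sq_le_norm:
  fixes A :: "real ^ 'm ^ 'n"
  assumes sys: "right_singular_system A \<sigma> \<phi>" and i: "i \<in> {1..CARD('m)}"
  shows "(\<sigma> i)\<^sup>2 \<le> (norm A)\<^sup>2"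
proof -
  note D = right_singular_systemD[OF sys]
  have n: "norm (\<phi> i) = 1" using D(3)[OF i i] by (simp add: norm_eq_1)
  have "(\<sigma> i)\<^sup>2 = \<phi> i \<bullet> ((transpose A ** A) *v \<phi> i)"
    unfolding D(4)[OF i] using n by (simp add: norm_eq_1)
  also have "\<dots> = (norm (A *v \<phi> i))\<^sup>2" by (simp add: inner_gram power2_norm_eq_inner)
  also have "\<dots> \<le> (norm A)\<^sup>2"
    using norm_matrix_vector_mult_le[of A "\<phi> i"] n by (intro power_mono) auto
  finally show ?thesis .
qed

lemma norm_pmf_vec_diff_le_chi2:
  fixes P Q :: "'a::finite pmf"
  assumes "set_pmf Q \<subseteq> set_pmf P"
  shows "(norm (pmf_vec Q - pmf_vec P))\<^sup>2 \<le> chi2 Q P"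
proof -
  have "(norm (pmf_vec Q - pmf_vec P))\<^sup>2 = (\<Sum>a\<in>UNIV. (pmf Q a - pmf P a)\<^sup>2)"
    unfolding power2_norm_eq_inner inner_vec_def by (simp add: pmf_vec_def power2_eq_square)
  also have "\<dots> = (\<Sum>a\<in>set_pmf P. (pmf Q a - pmf P a)\<^sup>2)"
    using assms by (intro sum.mono_neutral_right) (auto simp: set_pmf_iff)
  also have "\<dots> \<le> chi2 Q P"
    unfolding chi2_def
  proof (rule sum_mono)
    fix a assume "a \<in> set_pmf P"
    then have "0 < pmf P a" using pmf_nonneg[of P a] by (simp add: set_pmf_iff less_le)
    then show "(pmf Q a - pmf P a)\<^sup>2 \<le> (pmf Q a - pmf P a)\<^sup>2 / pmf P a"
      using pmf_le_1[of P a] by (simp add: divide_simps mult_left_le)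
  qed
  finally show ?thesis .
qed

lemma abs_pmf_diff_le: "\<bar>pmf Q a - pmf P a\<bar> \<le> norm (pmf_vec Q - pmf_vec P)" for a :: "'a::finite"
  using component_le_norm_cart[of "pmf_vec Q - pmf_vec P" a] by (simp add: pmf_vec_def)

lemma pmf_bounded_below:
  fixes P :: "'a::finite pmf"
  obtains p where "0 < p" "p \<le> 1" "\<And>a. a \<in> set_pmf P \<Longrightarrow> p \<le> pmf P a"
proof
  let ?p = "Min (insert 1 (pmf P ` set_pmf P))"
  show "0 < ?p" by (subst Min_gr_iff) (auto simp: set_pmf_iff less_le)
  show "?p \<le> 1" by (rule Min_le) auto
  show "?p \<le> pmf P a" if "a \<in> set_pmf P" for a using that by (intro Min_le) auto
qed

text \<open>Both remainders are at most \<open>g / 32\<close> times the square of \<open>h\<close>: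
  the first since each inner summand is at most \<open>\<rho> * h\<close> and
  \<open>5/256 \<le> 1/32\<close>, the second since it is of fourth order in
  \<open>h\<close>.\<close>

lemma remainder_le:
  fixes d g h \<rho> S C1 C2 :: real
  assumes d: "0 < d" and g: "0 < g" and h: "0 \<le> h" and S: "0 \<le> S" and C: "0 \<le> C1" "0 \<le> C2"
    and \<rho>: "0 \<le> \<rho>" "\<rho> \<le> g / (32 * d)" and h1: "h \<le> 1" and h2: "C1 * h \<le> \<rho>" and h3: "h * (d\<^sup>2 * S * C2\<^sup>2) \<le> g / 32"
  shows "5 * d\<^sup>2 / g * (\<rho> * h + C1 * h\<^sup>2)\<^sup>2 + d\<^sup>2 * S * (C2 * h\<^sup>2)\<^sup>2 \<le> g / 16 * h\<^sup>2"
proof -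
  have "\<rho> * h + C1 * h\<^sup>2 \<le> \<rho> * h + \<rho> * h"
    using mult_right_mono[OF h2 h] by (simp add: power2_eq_square mult_ac)
  also have "\<dots> \<le> 2 * (g / (32 * d)) * h" using mult_right_mono[OF \<rho>(2) h] by linarith
  finally have "(\<rho> * h + C1 * h\<^sup>2)\<^sup>2 \<le> (2 * (g / (32 * d)) * h)\<^sup>2"
    using \<rho> h C by (intro power_mono) auto
  then have "5 * d\<^sup>2 / g * (\<rho> * h + C1 * h\<^sup>2)\<^sup>2 \<le> 5 * d\<^sup>2 / g * (2 * (g / (32 * d)) * h)\<^sup>2"
    using g by (intro mult_left_mono) auto
  also have "\<dots> = 5 / 256 * (g * h\<^sup>2)" using d g by (simp add: power2_eq_square field_simps)
  also have "\<dots> \<le> g / 32 * h\<^sup>2" using g by (simp add: field_simps)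
  finally have 1: "5 * d\<^sup>2 / g * (\<rho> * h + C1 * h\<^sup>2)\<^sup>2 \<le> g / 32 * h\<^sup>2" .
  have "h * (h * (d\<^sup>2 * S * C2\<^sup>2)) \<le> 1 * (g / 32)"
    using h h1 h3 S g by (intro mult_mono) (auto intro!: mult_nonneg_nonneg)
  then have "h\<^sup>2 * (h * (h * (d\<^sup>2 * S * C2\<^sup>2))) \<le> h\<^sup>2 * (1 * (g / 32))" by (intro mult_left_mono) auto
  then have 2: "d\<^sup>2 * S * (C2 * h\<^sup>2)\<^sup>2 \<le> g / 32 * h\<^sup>2"
    by (simp add: power2_eq_square mult_ac)
  show ?thesis using 1 2 by simp
qed

section \<open>From the loss near \<open>P\<close> to relative entropy\<close>

context
  fixes P :: "('x::finite \<times> 'y::finite) pmf"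
  assumes PX_pos: "\<And>x. PX P x > 0" and PY_pos: "\<And>y. PY P y > 0"
begin

text \<open>The factor \<open>3/2\<close> is \<open>5/4\<close> from the quadratic bound plus
  \<open>1/4\<close> from the remainder, which is compared with \<open>alpha\<close> through
  \<open>g \<le> 4 * alpha P \<sigma> \<phi> k\<close>.\<close>

lemma local_loss_bound:
  obtains g r where "0 < g" "0 < r"
    "\<And>\<sigma> \<phi> k. right_singular_system (B_tilde P) \<sigma> \<phi> \<Longrightarrow> 1 \<le> k \<Longrightarrow> k < CARD('x) \<Longrightarrow> \<sigma> (k + 1) < \<sigma> k
      \<Longrightarrow> g \<le> 4 * alpha P \<sigma> \<phi> k"
    "\<And>\<sigma> \<phi> k F Q v. right_singular_system (B_tilde P) \<sigma> \<phi> \<Longrightarrow> 1 \<le> k \<Longrightarrow> k < CARD('x) \<Longrightarrow> \<sigma> (k + 1) < \<sigma> k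
      \<Longrightarrow> set_pmf Q \<subseteq> set_pmf P \<Longrightarrow> top_right_singular_vectors k (B_hat F Q) v
      \<Longrightarrow> norm (pmf_vec Q - pmf_vec P) < r
      \<Longrightarrow> (frob_norm k (\<lambda>i. B_tilde P *v \<phi> i))\<^sup>2 - (frob_norm k (\<lambda>i. B_tilde P *v v i))\<^sup>2
        \<le> 3/2 * alpha P \<sigma> \<phi> k * chi2 Q P"
proof -
  define A where "A = B_tilde P"
  obtain g where g: "0 < g" and gap: "\<And>\<sigma> \<phi> k. right_singular_system A \<sigma> \<phi> \<Longrightarrow> 1 \<le> k \<Longrightarrow> k < CARD('x) \<Longrightarrow> \<sigma> (k + 1) < \<sigma> k
      \<Longrightarrow> g \<le> (\<sigma> k)\<^sup>2 - (\<sigma> (k + 1))\<^sup>2"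
    using uniform_gap[of A] by blast
  obtain p where p: "0 < p" "\<And>a. a \<in> set_pmf P \<Longrightarrow> p \<le> pmf P a"
    by (rule pmf_bounded_below[of P]) blast
  define \<Delta> where "\<Delta> h = transpose (dB (pmf_vec P) h) ** A + transpose A ** dB (pmf_vec P) h" for h
  obtain K where K: "0 < K" "\<And>h. norm (\<Delta> h) \<le> K * norm h"
    using gram_expansion(1)[OF PX_pos PY_pos] unfolding \<Delta>_def A_def by blast
  define d where "d = real CARD('x)"
  have d: "0 < d" by (simp add: d_def)
  define \<rho> where "\<rho> = min 1 (g / (32 * d))"
  have \<rho>: "0 < \<rho>" "\<rho> \<le> 1" "\<rho> \<le> g / (32 * d)" using g d by (auto simp: \<rho>_def)
  obtain r0 where r0: "0 < r0" "\<And>q. norm (q - pmf_vec P) < r0 \<Longrightarrow>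
      norm (transpose (B_vec q) ** B_vec q - transpose A ** A - \<Delta> (q - pmf_vec P)) \<le> \<rho> * norm (q - pmf_vec P)"
    using gram_expansion(2)[OF PX_pos PY_pos \<rho>(1)] unfolding \<Delta>_def A_def by blast
  define C1 where "C1 = 4 * d^3 / g * (K + 1)\<^sup>2"
  define C2 where "C2 = 4 * d^5 / g\<^sup>2 * (K + 1)\<^sup>2"
  define C3 where "C3 = d\<^sup>2 * (norm A)\<^sup>2 * C2\<^sup>2"
  have C: "0 < C1" "0 \<le> C2" "0 \<le> C3" using d g K by (auto simp: C1_def C2_def C3_def)
  \<comment> \<open>\<open>r0\<close> secures the linearisation, \<open>p\<close> forces
    \<open>Q\<close> to have the support of \<open>P\<close>, and the last three entries are the
    conditions of \<open>remainder_le\<close>. The increment in \<open>C3 + 1\<close> avoids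
    division by zero.\<close>
  define r where "r = Min {r0, p, 1, \<rho> / C1, g / (32 * (C3 + 1))}"
  have r: "0 < r" "r \<le> r0" "r \<le> p" "r \<le> 1" "r \<le> \<rho> / C1" "r \<le> g / (32 * (C3 + 1))"
    using r0(1) p(1) \<rho>(1) C g by (simp_all add: r_def)
  show thesis
  proof
    fix \<sigma> \<phi> k assume sys: "right_singular_system (B_tilde P) \<sigma> \<phi>" and k: "1 \<le> k" "k < CARD('x)" "\<sigma> (k + 1) < \<sigma> k"
    note D = right_singular_systemD[OF sys]
    have gk: "g \<le> (\<sigma> k)\<^sup>2 - (\<sigma> (k+1))\<^sup>2" using gap sys k unfolding A_def by blast
    have "(\<sigma> k)\<^sup>2 \<le> (\<sigma> 1)\<^sup>2" using D(1)[of k] D(2)[of 1 k] k by (intro power_mono) auto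
    then have "g \<le> (\<sigma> 1)\<^sup>2" using gk zero_le_power2[of "\<sigma> (k+1)"] by linarith
    then show \<alpha>: "g \<le> 4 * alpha P \<sigma> \<phi> k" using alpha_ge[OF PX_pos PY_pos sys k] by simp
    fix F Q v
    assume ac: "set_pmf Q \<subseteq> set_pmf P" and top: "top_right_singular_vectors k (B_hat F Q) v"
      and close: "norm (pmf_vec Q - pmf_vec P) < r"
    define h where "h = norm (pmf_vec Q - pmf_vec P)"
    have h: "0 \<le> h" "h < r" using close by (auto simp: h_def)
    have "set_pmf P \<subseteq> set_pmf Q"
    proof
      fix a assume a: "a \<in> set_pmf P"
      have "0 < pmf Q a" using abs_pmf_diff_le[of Q a P] p(2)[OF a] h r by (simp add: h_def)
      then show "a \<in> set_pmf Q" by (simp add: set_pmf_iff)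
    qed
    then have same: "set_pmf Q = set_pmf P" using ac by blast
    \<comment> \<open>Equal supports make the marginals of \<open>Q\<close> positive, so
      \<open>B_hat\<close> is given by the smooth formula \<open>B_vec\<close>.\<close>
    have pos: "PX Q x > 0" "PY Q y > 0" for x y
      using PX_pos[of x] PY_pos[of y] same by (simp_all add: pmf_positive_iff)
    obtain s v' where sys': "right_singular_system (B_vec (pmf_vec Q)) s v'" and v: "\<And>i. i \<in> {1..k} \<Longrightarrow> v i = v' i"
      using top unfolding top_right_singular_vectors_def B_vec_pmf_vec[OF pos] by blast
    define H where "H = transpose (B_vec (pmf_vec Q)) ** B_vec (pmf_vec Q) - transpose A ** A"
    have lin: "norm (H - \<Delta> (pmf_vec Q - pmf_vec P)) \<le> \<rho> * h"
      unfolding H_def h_def using r0(2) h r by (simp add: h_def)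
    have "norm H \<le> norm (H - \<Delta> (pmf_vec Q - pmf_vec P)) + norm (\<Delta> (pmf_vec Q - pmf_vec P))"
      using norm_triangle_ineq[of "H - \<Delta> (pmf_vec Q - pmf_vec P)" "\<Delta> (pmf_vec Q - pmf_vec P)"] by simp
    also have "\<dots> \<le> \<rho> * h + K * h" using lin K(2) unfolding h_def by (rule add_mono)
    also have "\<dots> \<le> (K + 1) * h" using \<rho> h by (simp add: algebra_simps mult_right_le_one_le mult_left_le_one_le)
    finally have Hle: "norm H \<le> (K + 1) * h" .
    have frob: "frob_norm k (\<lambda>i. B_tilde P *v v i) = frob_norm k (\<lambda>i. A *v v' i)"
      unfolding frob_norm_def A_def by (simp add: v)
    \<comment> \<open>The first-order entries are the pairings of \<open>theta\<close> with
      \<open>L_mat P *v std_dev P Q\<close>, so the form of \<open>G_mat\<close> at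
      \<open>std_dev P Q\<close> appears.\<close>
    have quad: "(\<Sum>i=1..k. \<Sum>j=k+1..CARD('x). (\<phi> i \<bullet> (\<Delta> (pmf_vec Q - pmf_vec P) *v \<phi> j))\<^sup>2 / ((\<sigma> i)\<^sup>2 - (\<sigma> j)\<^sup>2))
        \<le> alpha P \<sigma> \<phi> k * chi2 Q P"
      using quadratic_le_alpha[where k = k and P = P and \<phi> = \<phi> and \<sigma> = \<sigma> and x = "std_dev P Q"]
      unfolding theta_inner mat_of_L_mat[OF ac] norm_std_dev \<Delta>_def A_def .
    have chi2: "h\<^sup>2 \<le> chi2 Q P" unfolding h_def by (rule norm_pmf_vec_diff_le_chi2[OF ac])
    have "(frob_norm k (\<lambda>i. A *v \<phi> i))\<^sup>2 - (frob_norm k (\<lambda>i. A *v v' i))\<^sup>2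
      \<le> 5/4 * (\<Sum>i=1..k. \<Sum>j=k+1..CARD('x). (\<phi> i \<bullet> (\<Delta> (pmf_vec Q - pmf_vec P) *v \<phi> j))\<^sup>2 / ((\<sigma> i)\<^sup>2 - (\<sigma> j)\<^sup>2))
      + 5 * d\<^sup>2 / g * (\<rho> * h + 4 * d^3 / g * ((K + 1) * h)\<^sup>2)\<^sup>2 + d\<^sup>2 * (\<sigma> 1)\<^sup>2 * (4 * d^5 / g\<^sup>2 * ((K + 1) * h)\<^sup>2)\<^sup>2"
      unfolding d_def using sys[folded A_def] sys' k(1,2) g gk Hle[unfolded H_def] lin[unfolded H_def] by (rule frob_loss_le)
    also have "\<dots> \<le> 5/4 * (alpha P \<sigma> \<phi> k * chi2 Q P) + g / 16 * h\<^sup>2"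
    proof -
      have e1: "4 * d^3 / g * ((K + 1) * h)\<^sup>2 = C1 * h\<^sup>2" and e2: "4 * d^5 / g\<^sup>2 * ((K + 1) * h)\<^sup>2 = C2 * h\<^sup>2"
        by (simp_all add: C1_def C2_def power_mult_distrib)
      have "5 * d\<^sup>2 / g * (\<rho> * h + C1 * h\<^sup>2)\<^sup>2 + d\<^sup>2 * (\<sigma> 1)\<^sup>2 * (C2 * h\<^sup>2)\<^sup>2 \<le> g / 16 * h\<^sup>2"
      proof (rule remainder_le)
        have "h \<le> \<rho> / C1" using h(2) r(5) by simp
        then show "C1 * h \<le> \<rho>" using C(1) by (simp add: pos_le_divide_eq mult.commute)
        have "(\<sigma> 1)\<^sup>2 \<le> (norm A)\<^sup>2" using singular_value_sq_le_norm[OF sys, of 1] k by (simp add: A_def)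
        then have "d\<^sup>2 * (\<sigma> 1)\<^sup>2 * C2\<^sup>2 \<le> C3" unfolding C3_def by (intro mult_right_mono mult_left_mono) auto
        then have "h * (d\<^sup>2 * (\<sigma> 1)\<^sup>2 * C2\<^sup>2) \<le> (g / (32 * (C3 + 1))) * (C3 + 1)"
          using h r C by (intro mult_mono) (auto intro!: mult_nonneg_nonneg)
        also have "\<dots> = g / 32"
        proof -
          have "(g / (32 * D)) * D = g / 32" if "D \<noteq> 0" for D :: real using that by simp
          then show ?thesis using C(3) by (metis add_nonneg_eq_0_iff zero_le_one zero_neq_one)
        qed
        finally show "h * (d\<^sup>2 * (\<sigma> 1)\<^sup>2 * C2\<^sup>2) \<le> g / 32" .
        show "h \<le> 1" using h(2) r(4) by simp
      qed (rule d g h(1) \<rho>(3) zero_le_power2 C(2) less_imp_le[OF C(1)] less_imp_le[OF \<rho>(1)])+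
      then show ?thesis unfolding e1 e2 add.assoc using quad by (intro add_mono) simp_all
    qed
    also have "g / 16 * h\<^sup>2 \<le> 4 * alpha P \<sigma> \<phi> k / 16 * chi2 Q P"
      using \<alpha> chi2 g by (intro mult_mono) auto
    finally show "(frob_norm k (\<lambda>i. B_tilde P *v \<phi> i))\<^sup>2 - (frob_norm k (\<lambda>i. B_tilde P *v v i))\<^sup>2
        \<le> 3/2 * alpha P \<sigma> \<phi> k * chi2 Q P"
      unfolding frob by (simp add: A_def mult_ac)
  qed (use g r in auto)
qed

text \<open>By contradiction, in two rounds. A crude comparison of \<open>chi2\<close> with
  \<open>kl\<close>, valid for every \<open>Q\<close> supported in the support of \<open>P\<close>,
  shows that small relative entropy forces \<open>Q\<close> close to \<open>P\<close>. There the
  comparison has constant \<open>2 + 2/15\<close>, and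
  \<open>3/2 * (2 + 2/15) = 4/5 * 4\<close>.\<close>

lemma loss_imp_kl_ge:
  obtains g where "0 < g"
    "\<And>\<sigma> \<phi> k. right_singular_system (B_tilde P) \<sigma> \<phi> \<Longrightarrow> 1 \<le> k \<Longrightarrow> k < CARD('x) \<Longrightarrow> \<sigma> (k + 1) < \<sigma> k
      \<Longrightarrow> g \<le> 4 * alpha P \<sigma> \<phi> k"
    "\<And>\<sigma> \<phi> k F Q v \<epsilon>. right_singular_system (B_tilde P) \<sigma> \<phi> \<Longrightarrow> 1 \<le> k \<Longrightarrow> k < CARD('x) \<Longrightarrow> \<sigma> (k + 1) < \<sigma> k
      \<Longrightarrow> set_pmf Q \<subseteq> set_pmf P \<Longrightarrow> top_right_singular_vectors k (B_hat F Q) v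
      \<Longrightarrow> \<epsilon> < g
      \<Longrightarrow> \<epsilon> < (frob_norm k (\<lambda>i. B_tilde P *v \<phi> i))\<^sup>2 - (frob_norm k (\<lambda>i. B_tilde P *v v i))\<^sup>2
      \<Longrightarrow> 5/4 * \<epsilon> / (4 * alpha P \<sigma> \<phi> k) \<le> kl Q P"
proof -
  obtain g r where g: "0 < g" "0 < r"
    and \<alpha>: "\<And>\<sigma> \<phi> k. right_singular_system (B_tilde P) \<sigma> \<phi> \<Longrightarrow> 1 \<le> k \<Longrightarrow> k < CARD('x) \<Longrightarrow> \<sigma> (k + 1) < \<sigma> k
      \<Longrightarrow> g \<le> 4 * alpha P \<sigma> \<phi> k"
    and loss: "\<And>\<sigma> \<phi> k F Q v. right_singular_system (B_tilde P) \<sigma> \<phi> \<Longrightarrow> 1 \<le> k \<Longrightarrow> k < CARD('x) \<Longrightarrow> \<sigma> (k + 1) < \<sigma> k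
      \<Longrightarrow> set_pmf Q \<subseteq> set_pmf P \<Longrightarrow> top_right_singular_vectors k (B_hat F Q) v
      \<Longrightarrow> norm (pmf_vec Q - pmf_vec P) < r
      \<Longrightarrow> (frob_norm k (\<lambda>i. B_tilde P *v \<phi> i))\<^sup>2 - (frob_norm k (\<lambda>i. B_tilde P *v v i))\<^sup>2
        \<le> 3/2 * alpha P \<sigma> \<phi> k * chi2 Q P"
    by (rule local_loss_bound) blast
  obtain p where p: "0 < p" "p \<le> 1" "\<And>a. a \<in> set_pmf P \<Longrightarrow> p \<le> pmf P a"
    by (rule pmf_bounded_below[of P]) blast
  define r' where "r' = min r (2/15 * p)"
  have r': "0 < r'" using g p by (simp add: r'_def)
  \<comment> \<open>By the crude comparison, relative entropy below \<kappa> puts \<open>Q\<close>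
    within distance \<open>r'\<close> of \<open>P\<close>.\<close>
  define \<kappa> where "\<kappa> = r'\<^sup>2 / (2 + 1 / p)"
  have \<kappa>: "0 < \<kappa>" using r' p by (simp add: \<kappa>_def add_pos_pos)
  show thesis
  proof
    \<comment> \<open>The factor \<open>4/5\<close> cancels the \<open>5/4\<close> in the negated
      claim, which then gives \<open>kl Q P < \<kappa>\<close>.\<close>
    show "0 < min g (4/5 * g * \<kappa>)" using g \<kappa> by simp
    fix \<sigma> \<phi> k assume sys: "right_singular_system (B_tilde P) \<sigma> \<phi>" "1 \<le> k" "k < CARD('x)" "\<sigma> (k + 1) < \<sigma> k"
    have \<alpha>': "g \<le> 4 * alpha P \<sigma> \<phi> k" by (rule \<alpha>[OF sys])
    then show "min g (4/5 * g * \<kappa>) \<le> 4 * alpha P \<sigma> \<phi> k" by simp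
    have \<alpha>0: "0 < alpha P \<sigma> \<phi> k" using \<alpha>' g by simp
    fix F Q v \<epsilon>
    assume ac: "set_pmf Q \<subseteq> set_pmf P" and top: "top_right_singular_vectors k (B_hat F Q) v"
      and \<epsilon>: "\<epsilon> < min g (4/5 * g * \<kappa>)"
      and large: "\<epsilon> < (frob_norm k (\<lambda>i. B_tilde P *v \<phi> i))\<^sup>2 - (frob_norm k (\<lambda>i. B_tilde P *v v i))\<^sup>2"
    show "5/4 * \<epsilon> / (4 * alpha P \<sigma> \<phi> k) \<le> kl Q P"
    proof (rule ccontr)
      assume "\<not> ?thesis"
      then have small: "kl Q P * (4 * alpha P \<sigma> \<phi> k) < 5/4 * \<epsilon>" using \<alpha>0 by (simp add: field_simps)
      have bound: "chi2 Q P \<le> (2 + 1 / p) * kl Q P"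
      proof (rule chi2_le_kl[OF ac])
        fix a assume a: "a \<in> set_pmf P"
        have "\<bar>pmf Q a - pmf P a\<bar> \<le> 1"
          using pmf_le_1[of P a] pmf_le_1[of Q a] pmf_nonneg[of P a] pmf_nonneg[of Q a] by linarith
        also have "1 \<le> 1 / p * pmf P a" using p(1) p(3)[OF a] by simp
        finally show "\<bar>pmf Q a - pmf P a\<bar> \<le> 1 / p * pmf P a" .
      qed
      have "0 \<le> chi2 Q P" by (simp add: chi2_def sum_nonneg)
      then have kl0: "0 \<le> kl Q P"
        using bound p by (smt (verit) divide_pos_pos mult_pos_neg)
      have "kl Q P * g \<le> kl Q P * (4 * alpha P \<sigma> \<phi> k)" using \<alpha>' kl0 by (intro mult_left_mono)
      also have "\<dots> < 5/4 * (4/5 * g * \<kappa>)" using small \<epsilon> by linarith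
      finally have "kl Q P * g < \<kappa> * g" by simp
      then have "kl Q P < \<kappa>" using g by simp
      then have "(2 + 1 / p) * kl Q P < (2 + 1 / p) * \<kappa>" using p by (intro mult_strict_left_mono) (auto simp: add_pos_pos)
      also have "\<dots> = r'\<^sup>2" using p by (simp add: \<kappa>_def add_pos_pos less_imp_neq[symmetric])
      finally have "(norm (pmf_vec Q - pmf_vec P))\<^sup>2 < r'\<^sup>2"
        using bound norm_pmf_vec_diff_le_chi2[OF ac] by linarith
      then have close: "norm (pmf_vec Q - pmf_vec P) < r'"
        by (rule power2_less_imp_less) (use r' in simp)
      have "chi2 Q P \<le> (2 + 2/15) * kl Q P"
      proof (rule chi2_le_kl[OF ac])
        fix a assume a: "a \<in> set_pmf P"
        then show "\<bar>pmf Q a - pmf P a\<bar> \<le> 2/15 * pmf P a"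
          using abs_pmf_diff_le[of Q a P] close p(3)[OF a] by (simp add: r'_def)
      qed
      then have "3/2 * alpha P \<sigma> \<phi> k * chi2 Q P \<le> 3/2 * alpha P \<sigma> \<phi> k * ((2 + 2/15) * kl Q P)"
        using \<alpha>0 by (intro mult_left_mono) auto
      also have "\<dots> = 4/5 * (kl Q P * (4 * alpha P \<sigma> \<phi> k))" by simp
      also have "\<dots> < \<epsilon>" using small by simp
      finally show False
        using loss[OF sys ac top] close large by (simp add: r'_def)
    qed
  qed
qed

end

text \<open>The order of quantifiers makes \<open>\<epsilon>0\<close> depend on \<open>P\<close>
  alone. Quantifying over \<open>F\<close> and \<open>\<Phi>hat\<close> covers every convention for
  vanishing denominators and ties, even one that varies with the sample.\<close>

theorem theorem2:
  fixes P :: "('x::finite \<times> 'y::finite) pmf"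
  assumes PX_pos: "\<And>x. PX P x > 0"
    and PY_pos: "\<And>y. PY P y > 0"
  shows "\<exists>\<epsilon>0 > 0. \<forall>k \<in> {1..CARD('x) - 1}. \<forall>\<sigma> \<phi>.
    right_singular_system (B_tilde P) \<sigma> \<phi> \<longrightarrow> \<sigma> k > \<sigma> (k + 1) \<longrightarrow>
    (\<forall>(F :: nat \<Rightarrow> (nat \<Rightarrow> 'x \<times> 'y) \<Rightarrow> real ^ 'x ^ 'y)
      (\<Phi>hat :: nat \<Rightarrow> (nat \<Rightarrow> 'x \<times> 'y) \<Rightarrow> nat \<Rightarrow> real ^ 'x).
      (\<forall>n \<omega>. top_right_singular_vectors k (B_hat (F n \<omega>) (empirical n \<omega>)) (\<Phi>hat n \<omega>)) \<longrightarrow>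
      (\<forall>\<epsilon> \<in> {0<..<\<epsilon>0}. \<forall>\<delta> \<in> {0<..<1}. \<forall>n::nat.
        real n > N_bound (4 * alpha P \<sigma> \<phi> k) (CARD('x) * CARD('y)) \<epsilon> \<delta> \<longrightarrow>
        measure_pmf.prob (iid_samples n P)
          {\<omega>. (frob_norm k (\<lambda>i. B_tilde P *v \<phi> i))\<^sup>2
             - (frob_norm k (\<lambda>i. B_tilde P *v \<Phi>hat n \<omega> i))\<^sup>2 > \<epsilon>} < \<delta>))"
proof -
  obtain g where g: "0 < g"
    and \<alpha>: "\<And>\<sigma> \<phi> k. right_singular_system (B_tilde P) \<sigma> \<phi> \<Longrightarrow> 1 \<le> k \<Longrightarrow> k < CARD('x) \<Longrightarrow> \<sigma> (k + 1) < \<sigma> k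
      \<Longrightarrow> g \<le> 4 * alpha P \<sigma> \<phi> k"
    and kl: "\<And>\<sigma> \<phi> k F Q v \<epsilon>. right_singular_system (B_tilde P) \<sigma> \<phi> \<Longrightarrow> 1 \<le> k \<Longrightarrow> k < CARD('x) \<Longrightarrow> \<sigma> (k + 1) < \<sigma> k
      \<Longrightarrow> set_pmf Q \<subseteq> set_pmf P \<Longrightarrow> top_right_singular_vectors k (B_hat F Q) v \<Longrightarrow> \<epsilon> < g
      \<Longrightarrow> \<epsilon> < (frob_norm k (\<lambda>i. B_tilde P *v \<phi> i))\<^sup>2 - (frob_norm k (\<lambda>i. B_tilde P *v v i))\<^sup>2
      \<Longrightarrow> 5/4 * \<epsilon> / (4 * alpha P \<sigma> \<phi> k) \<le> kl Q P"
    by (rule loss_imp_kl_ge[OF PX_pos PY_pos]) blast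
  show ?thesis
  proof (intro exI[of _ g] conjI g ballI allI impI)
    fix k \<sigma> \<phi> and F :: "nat \<Rightarrow> (nat \<Rightarrow> 'x \<times> 'y) \<Rightarrow> real ^ 'x ^ 'y"
      and \<Phi>hat :: "nat \<Rightarrow> (nat \<Rightarrow> 'x \<times> 'y) \<Rightarrow> nat \<Rightarrow> real ^ 'x" and \<epsilon> \<delta> and n :: nat
    assume k: "k \<in> {1..CARD('x) - 1}" and sys: "right_singular_system (B_tilde P) \<sigma> \<phi>" and gap: "\<sigma> (k + 1) < \<sigma> k"
      and top: "\<forall>n \<omega>. top_right_singular_vectors k (B_hat (F n \<omega>) (empirical n \<omega>)) (\<Phi>hat n \<omega>)"
      and \<epsilon>: "\<epsilon> \<in> {0<..<g}" and \<delta>: "\<delta> \<in> {0<..<1}"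
      and n: "real n > N_bound (4 * alpha P \<sigma> \<phi> k) (CARD('x) * CARD('y)) \<epsilon> \<delta>"
    have k': "1 \<le> k" "k < CARD('x)" using k by auto
    note \<alpha>k = \<alpha>[OF sys k' gap]
    have m: "1 \<le> CARD('x) * CARD('y)" by (simp add: Suc_le_eq)
    \<comment> \<open>This excludes the empty sample, for which \<open>empirical\<close> has no
      meaningful value.\<close>
    have "n > 0"
      by (rule N_bound_suffices(1)[OF _ _ m _ _ n]) (use \<alpha>k \<epsilon> \<delta> in auto)
    let ?A = "{\<omega>. (frob_norm k (\<lambda>i. B_tilde P *v \<phi> i))\<^sup>2 - (frob_norm k (\<lambda>i. B_tilde P *v \<Phi>hat n \<omega> i))\<^sup>2 > \<epsilon>}"
    have "measure_pmf.prob (iid_samples n P) ?A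
      \<le> (real n + 1) ^ CARD('x \<times> 'y) * exp (- real n * (5/4 * \<epsilon> / (4 * alpha P \<sigma> \<phi> k)))"
    proof (rule prob_kl_ge[OF \<open>n > 0\<close>])
      fix \<omega> assume "\<omega> \<in> ?A" "\<omega> \<in> set_pmf (iid_samples n P)"
      then show "5/4 * \<epsilon> / (4 * alpha P \<sigma> \<phi> k) \<le> kl (empirical n \<omega>) P"
        using kl[OF sys k' gap set_empirical_subset[OF \<open>n > 0\<close>] top[rule_format]] \<epsilon> by simp
    qed
    also have "\<dots> < \<delta>"
      unfolding card_prod by (rule N_bound_suffices(2)[OF _ _ m _ _ n]) (use \<alpha>k \<epsilon> \<delta> in auto)
    finally show "measure_pmf.prob (iid_samples n P) ?A < \<delta>" .
  qed
qed

end
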